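(* Let $X$ be a compact toric manifold (not necessarily Fano) with $T^n$-invariant Kähler form $\omega$, and let $u\in\mathbb R^n$. There exists a $\Lambda$-algebra isomorphism $$\psi_u:QH^{\omega}(X;\Lambda)\cong Jac(\mathfrak{PO}_0^u)$$ such that $\psi_u(z_i)=\overline z_i(u)$ for $i=1,\dots,m$.
   Context: $\Lambda=\{\sum_{i\ge1}a_iT^{\lambda_i}:a_i\in\mathbb Q,\ \lambda_i\in\mathbb R,\ \lambda_i\to\infty\}$. $X$ is a smooth compact toric manifold of complex dimension $n$ with fan $\Sigma$ and moment polytope $P=\{u\in\mathbb R^n:\ell_i(u)\ge0,\ i=1,\dots,m\}$, $\ell_i(u)=\langle u,v_i\rangle-\lambda_i$, where $v_i=(v_{i,1},\dots,v_{i,n})\in\mathbb Z^n$ are the primitive inward facet normals, i.e. the generators of the rays of $\Sigma$. Batyrev quantum cohomology ring: a set $\mathcal P\subset\{1,\dots,m\}$ is a primitive collection if $\{v_i\}_{i\in\mathcal P}$ does not span a cone of $\Sigma$ but every proper subset does. Then there are a unique $\mathcal P'$ with $\{v_{i'}\}_{i'\in\mathcal P'}$ spanning a cone of $\Sigma$ and unique positive integers $k_{i'}$ with $\sum_{i\in\mathcal P}v_i=\sum_{i'\in\mathcal P'}k_{i'}v_{i'}$; put $\omega(\mathcal P)=\sum_{i\in\mathcal P}\ell_i(u)-\sum_{i'\in\mathcal P'}k_{i'}\ell_{i'}(u)$ (independent of $u$). $SR_\omega(X)\subset\Lambda[z_1,\dots,z_m]$ is the ideal generated by $\prod_{i\in\mathcal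 P}z_i-T^{\omega(\mathcal P)}\prod_{i'\in\mathcal P'}z_{i'}^{k_{i'}}$ over all primitive collections; $P(X)$ is the ideal generated by $\sum_{i=1}^mv_{i,j}z_i$, $j=1,\dots,n$. $QH^\omega(X;\Lambda)=\Lambda[z_1,\dots,z_m]/(P(X)+SR_\omega(X))$. $\overline z_i(u)=y_1^{v_{i,1}}\cdots y_n^{v_{i,n}}T^{\ell_i(u)}$, $\mathfrak{PO}_0^u=\sum_{i=1}^m\overline z_i(u)$, and $Jac(\mathfrak{PO}_0^u)=\Lambda[y_1^{\pm1},\dots,y_n^{\pm1}]/(\partial\mathfrak{PO}_0^u/\partial y_i;\ i=1,\dots,n)$. *)

theory Defs
  imports
    "HOL-Analysis.Analysis"
    "HOL-Library.Poly_Mapping"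
    "HOL-Algebra.QuotRing"
    "HOL-Algebra.Algebraic_Closure_Type"
begin

section \<open>The Novikov ring \<open>\<Lambda>\<close>\<close>

text \<open>
  A formal sum \<open>\<Sum>\<^sub>i a\<^sub>i T\<^sup>\<lambda>\<^sub>i\<close> with \<open>a\<^sub>i\<close> rational and
  \<open>\<lambda>\<^sub>i \<rightarrow> \<infinity>\<close> is represented by its coefficient function
  \<open>real \<Rightarrow> rat\<close>; the condition \<open>\<lambda>\<^sub>i \<rightarrow> \<infinity>\<close> says that only finitely many exponents with
  nonzero coefficient lie below any given bound.
\<close>

definition novikov_support :: "(real \<Rightarrow> rat) \<Rightarrow> bool" where
  "novikov_support f \<longleftrightarrow> (\<forall>c. finite {x. x \<le> c \<and> f x \<noteq> 0})"

typedef novikov = "{f :: real \<Rightarrow> rat. novikov_support f}"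
  morphisms novikov_coeff Abs_novikov
  by (rule exI[of _ "\<lambda>_. 0"]) (simp add: novikov_support_def)

setup_lifting type_definition_novikov

definition novikov_conv :: "(real \<Rightarrow> rat) \<Rightarrow> (real \<Rightarrow> rat) \<Rightarrow> real \<Rightarrow> rat" where
  "novikov_conv f g z = (\<Sum>a | f a \<noteq> 0 \<and> g (z - a) \<noteq> 0. f a * g (z - a))"

lemma novikov_support_lower:
  assumes "novikov_support f"
  obtains L where "\<And>x. f x \<noteq> 0 \<Longrightarrow> L \<le> x"
proof -
  let ?S = "insert 0 {x. x \<le> 0 \<and> f x \<noteq> 0}"
  have fin: "finite ?S" using assms by (simp add: novikov_support_def)
  have "Min ?S \<le> x" if "f x \<noteq> 0" for x
  proof (cases "x \<le> 0")
    case True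
    then have "x \<in> ?S" using that by simp
    then show ?thesis by (rule Min_le[OF fin])
  next
    case False
    have "Min ?S \<le> 0" by (rule Min_le[OF fin]) simp
    then show ?thesis using False by linarith
  qed
  then show ?thesis using that by blast
qed

lemma novikov_conv_superset:
  assumes "finite A" "\<And>a. f a \<noteq> 0 \<Longrightarrow> g (z - a) \<noteq> 0 \<Longrightarrow> a \<in> A"
  shows "novikov_conv f g z = (\<Sum>a\<in>A. f a * g (z - a))"
  unfolding novikov_conv_def using assms by (intro sum.mono_neutral_left) auto

lemma novikov_conv_eq:
  assumes f: "novikov_support f" and L: "\<And>x. g x \<noteq> 0 \<Longrightarrow> L \<le> x" and c: "z - L \<le> c"
  shows "novikov_conv f g z = (\<Sum>a | a \<le> c \<and> f a \<noteq> 0. f a * g (z - a))"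
proof (rule novikov_conv_superset)
  show "finite {a. a \<le> c \<and> f a \<noteq> 0}" using f by (simp add: novikov_support_def)
next
  fix a assume "f a \<noteq> 0" "g (z - a) \<noteq> 0"
  then show "a \<in> {a. a \<le> c \<and> f a \<noteq> 0}" using L[of "z - a"] c by simp
qed

lemma novikov_conv_nonzero:
  assumes "novikov_conv f g z \<noteq> 0"
  obtains a where "f a \<noteq> 0" "g (z - a) \<noteq> 0"
proof -
  have "\<exists>a. f a \<noteq> 0 \<and> g (z - a) \<noteq> 0"
  proof (rule ccontr)
    assume "\<not> ?thesis"
    then have "{a. f a \<noteq> 0 \<and> g (z - a) \<noteq> 0} = {}" by blast
    then show False using assms unfolding novikov_conv_def by (metis sum.empty)
  qed
  then show ?thesis using that by blast
qed

lemma novikov_support_conv: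
  assumes f: "novikov_support f" and g: "novikov_support g"
  shows "novikov_support (novikov_conv f g)"
  unfolding novikov_support_def
proof
  fix c
  obtain L where L: "\<And>x. f x \<noteq> 0 \<Longrightarrow> L \<le> x" using novikov_support_lower[OF f] by blast
  obtain M where M: "\<And>x. g x \<noteq> 0 \<Longrightarrow> M \<le> x" using novikov_support_lower[OF g] by blast
  let ?A = "{x. x \<le> c - M \<and> f x \<noteq> 0}" and ?B = "{x. x \<le> c - L \<and> g x \<noteq> 0}"
  have "{x. x \<le> c \<and> novikov_conv f g x \<noteq> 0} \<subseteq> (\<lambda>(a, b). a + b) ` (?A \<times> ?B)"
  proof
    fix z assume z: "z \<in> {x. x \<le> c \<and> novikov_conv f g x \<noteq> 0}"
    then obtain a where a: "f a \<noteq> 0" "g (z - a) \<noteq> 0" by (auto elim: novikov_conv_nonzero)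
    have "a \<in> ?A" "z - a \<in> ?B" using a z L[OF a(1)] M[OF a(2)] by auto
    then show "z \<in> (\<lambda>(a, b). a + b) ` (?A \<times> ?B)" by (intro image_eqI[of _ _ "(a, z - a)"]) auto
  qed
  moreover have "finite (?A \<times> ?B)" using f g by (auto simp: novikov_support_def)
  ultimately show "finite {x. x \<le> c \<and> novikov_conv f g x \<noteq> 0}"
    by (meson finite_imageI finite_subset)
qed

lemma novikov_conv_commute: "novikov_conv f g = novikov_conv g f"
proof
  fix z
  show "novikov_conv f g z = novikov_conv g f z"
    unfolding novikov_conv_def
    by (rule sum.reindex_bij_witness[of _ "\<lambda>b. z - b" "\<lambda>a. z - a"]) (auto simp: mult.commute)
qed

lemma novikov_conv_assoc:
  assumes f: "novikov_support f" and g: "novikov_support g" and h: "novikov_support h"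
  shows "novikov_conv (novikov_conv f g) h = novikov_conv f (novikov_conv g h)"
proof
  fix z
  obtain M where M: "\<And>x. g x \<noteq> 0 \<Longrightarrow> M \<le> x" using novikov_support_lower[OF g] by blast
  obtain N where N: "\<And>x. h x \<noteq> 0 \<Longrightarrow> N \<le> x" using novikov_support_lower[OF h] by blast
  define A where "A = {a. a \<le> z - N - M \<and> f a \<noteq> 0}"
  define E where "E = (\<lambda>a. {b. b \<le> z - a - N \<and> g b \<noteq> 0})"
  define D where "D = {d. d \<le> z - N \<and> novikov_conv f g d \<noteq> 0} \<union> (\<Union>a\<in>A. (\<lambda>b. a + b) ` E a)"
  have fg: "novikov_support (novikov_conv f g)" by (rule novikov_support_conv[OF f g])
  have finA: "finite A" using f by (simp add: A_def novikov_support_def)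
  have finE: "finite (E a)" for a using g by (simp add: E_def novikov_support_def)
  have finD: "finite D" using fg finA finE by (auto simp: D_def novikov_support_def)
  have Dle: "d \<le> z - N" if "d \<in> D" for d using that by (auto simp: D_def E_def)
  have 1: "novikov_conv (novikov_conv f g) h z = (\<Sum>d\<in>D. novikov_conv f g d * h (z - d))"
  proof (rule novikov_conv_superset[OF finD])
    fix d assume "novikov_conv f g d \<noteq> 0" "h (z - d) \<noteq> 0"
    then show "d \<in> D" using N[of "z - d"] by (auto simp: D_def)
  qed
  have 2: "novikov_conv f g d = (\<Sum>a\<in>A. f a * g (d - a))" if "d \<in> D" for d
    unfolding A_def by (rule novikov_conv_eq[OF f M]) (use Dle[OF that] in auto)
  have 3: "novikov_conv g h (z - a) = (\<Sum>d\<in>D. g (d - a) * h (z - d))" if a: "a \<in> A" for a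
  proof -
    have "novikov_conv g h (z - a) = (\<Sum>b\<in>(\<lambda>d. d - a) ` D. g b * h (z - a - b))"
    proof (rule novikov_conv_superset)
      show "finite ((\<lambda>d. d - a) ` D)" using finD by simp
    next
      fix b assume b: "g b \<noteq> 0" "h (z - a - b) \<noteq> 0"
      then have "b \<in> E a" using N[OF b(2)] by (auto simp: E_def)
      then have "a + b \<in> D" using a by (auto simp: D_def)
      then show "b \<in> (\<lambda>d. d - a) ` D" by (intro image_eqI[of _ _ "a + b"]) auto
    qed
    also have "\<dots> = (\<Sum>d\<in>D. g (d - a) * h (z - d))"
      by (subst sum.reindex) (auto simp: inj_on_def)
    finally show ?thesis .
  qed
  have 4: "novikov_conv f (novikov_conv g h) z = (\<Sum>a\<in>A. f a * novikov_conv g h (z - a))"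
  proof (rule novikov_conv_superset[OF finA])
    fix a assume a: "f a \<noteq> 0" "novikov_conv g h (z - a) \<noteq> 0"
    then obtain b where b: "g b \<noteq> 0" "h (z - a - b) \<noteq> 0" by (auto elim: novikov_conv_nonzero)
    show "a \<in> A" using a M[OF b(1)] N[OF b(2)] by (auto simp: A_def)
  qed
  have "novikov_conv (novikov_conv f g) h z = (\<Sum>d\<in>D. \<Sum>a\<in>A. f a * (g (d - a) * h (z - d)))"
    unfolding 1 by (rule sum.cong) (auto simp: 2 sum_distrib_right mult.assoc)
  also have "\<dots> = (\<Sum>a\<in>A. \<Sum>d\<in>D. f a * (g (d - a) * h (z - d)))" by (rule sum.swap)
  also have "\<dots> = novikov_conv f (novikov_conv g h) z"
    unfolding 4 by (rule sum.cong) (auto simp: 3 sum_distrib_left)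
  finally show "novikov_conv (novikov_conv f g) h z = novikov_conv f (novikov_conv g h) z" .
qed

lemma novikov_support_add:
  assumes "novikov_support f" "novikov_support g"
  shows "novikov_support (\<lambda>x. f x + g x)"
  unfolding novikov_support_def
proof
  fix c
  have "{x. x \<le> c \<and> f x + g x \<noteq> 0} \<subseteq> {x. x \<le> c \<and> f x \<noteq> 0} \<union> {x. x \<le> c \<and> g x \<noteq> 0}" by auto
  then show "finite {x. x \<le> c \<and> f x + g x \<noteq> 0}"
    by (rule finite_subset) (use assms in \<open>simp add: novikov_support_def\<close>)
qed

lemma novikov_support_uminus: "novikov_support f \<Longrightarrow> novikov_support (\<lambda>x. - f x)"
  by (simp add: novikov_support_def)

lemma novikov_support_single: "novikov_support (\<lambda>x. if x = r then q else 0)"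
proof -
  have "finite {x. x \<le> c \<and> (if x = r then q else 0) \<noteq> 0}" for c
    by (rule finite_subset[of _ "{r}"]) auto
  then show ?thesis by (simp add: novikov_support_def)
qed

lemma novikov_conv_add_left:
  assumes f: "novikov_support f" and g: "novikov_support g" and h: "novikov_support h"
  shows "novikov_conv (\<lambda>x. f x + g x) h = (\<lambda>x. novikov_conv f h x + novikov_conv g h x)"
proof
  fix z
  obtain N where N: "\<And>x. h x \<noteq> 0 \<Longrightarrow> N \<le> x" using novikov_support_lower[OF h] by blast
  define A where "A = {a. a \<le> z - N \<and> f a \<noteq> 0} \<union> {a. a \<le> z - N \<and> g a \<noteq> 0}"
  have finA: "finite A" using f g by (simp add: A_def novikov_support_def)
  have le: "a \<le> z - N" if "h (z - a) \<noteq> 0" for a using N[OF that] by simp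
  have *: "novikov_conv k h z = (\<Sum>a\<in>A. k a * h (z - a))"
    if "\<And>a. k a \<noteq> 0 \<Longrightarrow> f a \<noteq> 0 \<or> g a \<noteq> 0" for k
    by (rule novikov_conv_superset[OF finA]) (use that le in \<open>auto simp: A_def\<close>)
  show "novikov_conv (\<lambda>x. f x + g x) h z = novikov_conv f h z + novikov_conv g h z"
    by (subst (1 2 3) *) (auto simp: sum.distrib ring_distribs)
qed

lemma novikov_conv_one: "novikov_conv (\<lambda>x. if x = 0 then 1 else 0) g = g"
proof
  fix z
  have "novikov_conv (\<lambda>x. if x = 0 then 1 else 0) g z =
      (\<Sum>a\<in>{0}. (if a = 0 then 1 else 0) * g (z - a))"
    by (rule novikov_conv_superset) (auto split: if_splits)
  then show "novikov_conv (\<lambda>x. if x = 0 then 1 else 0) g z = g z" by simp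
qed

instantiation novikov :: comm_ring_1
begin

lift_definition zero_novikov :: novikov is "\<lambda>_. 0"
  by (simp add: novikov_support_def)

lift_definition one_novikov :: novikov is "\<lambda>x. if x = 0 then 1 else 0"
  by (rule novikov_support_single)

lift_definition plus_novikov :: "novikov \<Rightarrow> novikov \<Rightarrow> novikov" is "\<lambda>f g x. f x + g x"
  by (rule novikov_support_add)

lift_definition uminus_novikov :: "novikov \<Rightarrow> novikov" is "\<lambda>f x. - f x"
  by (rule novikov_support_uminus)

lift_definition minus_novikov :: "novikov \<Rightarrow> novikov \<Rightarrow> novikov" is "\<lambda>f g x. f x - g x"
  using novikov_support_add[OF _ novikov_support_uminus] by simp

lift_definition times_novikov :: "novikov \<Rightarrow> novikov \<Rightarrow> novikov" is novikov_conv
  by (rule novikov_support_conv)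

instance
proof
  fix a b c :: novikov
  show "a * b * c = a * (b * c)" by transfer (rule novikov_conv_assoc)
  show "a * b = b * a" by transfer (rule novikov_conv_commute)
  show "1 * a = a" by transfer (rule novikov_conv_one)
  show "a + b + c = a + (b + c)" by transfer (simp add: add.assoc)
  show "a + b = b + a" by transfer (simp add: add.commute)
  show "0 + a = a" by transfer simp
  show "- a + a = 0" by transfer simp
  show "a - b = a + - b" by transfer simp
  show "(a + b) * c = a * c + b * c" by transfer (rule novikov_conv_add_left)
  show "(0::novikov) \<noteq> 1" by transfer (metis zero_neq_one)
qed

end

lift_definition Tpow :: "real \<Rightarrow> novikov" is "\<lambda>r x. if x = r then 1 else 0"
  by (rule novikov_support_single)

section \<open>Smooth complete fans and moment polytopes\<close>

definition real_vec :: "int ^ 'n \<Rightarrow> real ^ 'n" where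
  "real_vec w = (\<chi> j. real_of_int (w $ j))"

definition primitive_vec :: "int ^ 'n \<Rightarrow> bool" where
  "primitive_vec w \<longleftrightarrow> Gcd (range (\<lambda>j. w $ j)) = 1"

definition lattice_basis :: "(int ^ 'n) set \<Rightarrow> bool" where
  "lattice_basis B \<longleftrightarrow> finite B \<and>
     (\<forall>x. \<exists>!c :: int ^ 'n \<Rightarrow> int. (\<forall>b. b \<notin> B \<longrightarrow> c b = 0) \<and> x = (\<Sum>b\<in>B. c b *s b))"

text \<open>The subset \<open>S\<close> may be empty, so that the zero cone is regular.\<close>

definition regular_cone :: "(real ^ 'n) set \<Rightarrow> bool" where
  "regular_cone \<sigma> \<longleftrightarrow>
     (\<exists>B S. lattice_basis B \<and> S \<subseteq> B \<and> \<sigma> = convex_cone hull (real_vec ` S))"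

definition smooth_complete_fan :: "(real ^ 'n) set set \<Rightarrow> bool" where
  "smooth_complete_fan \<Sigma> \<longleftrightarrow>
     finite \<Sigma> \<and>
     (\<forall>\<sigma>\<in>\<Sigma>. regular_cone \<sigma>) \<and>
     (\<forall>\<sigma>\<in>\<Sigma>. \<forall>\<tau>. \<tau> face_of \<sigma> \<and> \<tau> \<noteq> {} \<longrightarrow> \<tau> \<in> \<Sigma>) \<and>
     (\<forall>\<sigma>\<in>\<Sigma>. \<forall>\<tau>\<in>\<Sigma>. (\<sigma> \<inter> \<tau>) face_of \<sigma> \<and> (\<sigma> \<inter> \<tau>) face_of \<tau>) \<and>
     \<Union>\<Sigma> = UNIV"

definition ray_generators :: "(real ^ 'n) set set \<Rightarrow> (int ^ 'n) set" where
  "ray_generators \<Sigma> = {w. primitive_vec w \<and> convex_cone hull {real_vec w} \<in> \<Sigma>}"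

text \<open>The affine functions \<open>\<ell>\<^sub>i\<close>; the family \<open>v\<close> of facet normals is indexed by a
  finite type \<open>'m\<close> with \<open>m\<close> elements.\<close>

definition ell :: "('m \<Rightarrow> int ^ 'n) \<Rightarrow> ('m \<Rightarrow> real) \<Rightarrow> 'm \<Rightarrow> real ^ 'n \<Rightarrow> real" where
  "ell v lam i u = u \<bullet> real_vec (v i) - lam i"

definition moment_polytope :: "('m \<Rightarrow> int ^ 'n) \<Rightarrow> ('m \<Rightarrow> real) \<Rightarrow> (real ^ 'n) set" where
  "moment_polytope v lam = {u. \<forall>i. ell v lam i u \<ge> 0}"

text \<open>Inward normal fan: the cone of a face \<open>F\<close> consists of the linear functionals whose minimum
  over \<open>P\<close> is attained along all of \<open>F\<close>.\<close>

definition normal_cone :: "(real ^ 'n) set \<Rightarrow> (real ^ 'n) set \<Rightarrow> (real ^ 'n) set" where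
  "normal_cone P F = {w. \<forall>x\<in>P. \<forall>y\<in>F. w \<bullet> y \<le> w \<bullet> x}"

definition normal_fan :: "(real ^ 'n) set \<Rightarrow> (real ^ 'n) set set" where
  "normal_fan P = {normal_cone P F | F. F face_of P \<and> F \<noteq> {}}"

text \<open>
  The combinatorial data of a compact toric manifold of complex dimension \<open>CARD('n)\<close> together
  with a torus-invariant Kaehler form: by the classification theorems, the manifold is given by
  a smooth complete fan \<open>\<Sigma>\<close> and the Kaehler form, up to equivariant symplectomorphism, by
  the moment polytope, whose inward normal fan is \<open>\<Sigma>\<close>. Completeness of the fan makes the
  polytope bounded, and each \<open>\<ell>\<^sub>i\<close> cuts out a facet because \<open>v\<^sub>i\<close> spans
  a ray of the normal fan.
\<close>

definition compact_toric_manifold ::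
    "(real ^ 'n) set set \<Rightarrow> ('m::finite \<Rightarrow> int ^ 'n) \<Rightarrow> ('m \<Rightarrow> real) \<Rightarrow> bool" where
  "compact_toric_manifold \<Sigma> v lam \<longleftrightarrow>
     smooth_complete_fan \<Sigma> \<and>
     bij_betw v UNIV (ray_generators \<Sigma>) \<and>
     normal_fan (moment_polytope v lam) = \<Sigma>"

section \<open>Algebras over a commutative ring\<close>

text \<open>
  An algebra over \<open>'k\<close> is a ring \<open>A\<close> with a structure map \<open>\<alpha>\<close> from
  \<open>'k\<close>; an algebra isomorphism is a ring isomorphism compatible with the structure maps.
\<close>

definition algebra_iso ::
    "('k \<Rightarrow> 'a) \<Rightarrow> ('a, 'c) ring_scheme \<Rightarrow> ('k \<Rightarrow> 'b) \<Rightarrow> ('b, 'd) ring_scheme \<Rightarrow> ('a \<Rightarrow> 'b) \<Rightarrow> bool" where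
  "algebra_iso \<alpha> A \<beta> B \<psi> \<longleftrightarrow> \<psi> \<in> ring_iso A B \<and> (\<forall>c. \<psi> (\<alpha> c) = \<beta> c)"

section \<open>Batyrev quantum cohomology\<close>

text \<open>\<open>\<Lambda>[z\<^sub>1,\<dots>,z\<^sub>m]\<close>, with exponent vectors \<open>'m \<Rightarrow>\<^sub>0 nat\<close>.\<close>

type_synonym 'm zpoly = "('m \<Rightarrow>\<^sub>0 nat) \<Rightarrow>\<^sub>0 novikov"

definition zvar :: "'m \<Rightarrow> 'm zpoly" where
  "zvar i = Poly_Mapping.single (Poly_Mapping.single i 1) 1"

definition zconst :: "novikov \<Rightarrow> 'm zpoly" where
  "zconst c = Poly_Mapping.single 0 c"

abbreviation zpoly_ring :: "'m zpoly ring" where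
  "zpoly_ring \<equiv> ring_of_type_algebra"

definition spans_cone :: "(real ^ 'n) set set \<Rightarrow> ('m \<Rightarrow> int ^ 'n) \<Rightarrow> 'm set \<Rightarrow> bool" where
  "spans_cone \<Sigma> v I \<longleftrightarrow> convex_cone hull ((\<lambda>i. real_vec (v i)) ` I) \<in> \<Sigma>"

definition primitive_collection ::
    "(real ^ 'n) set set \<Rightarrow> ('m \<Rightarrow> int ^ 'n) \<Rightarrow> 'm set \<Rightarrow> bool" where
  "primitive_collection \<Sigma> v I \<longleftrightarrow> \<not> spans_cone \<Sigma> v I \<and> (\<forall>J. J \<subset> I \<longrightarrow> spans_cone \<Sigma> v J)"

definition primitive_relation ::
    "(real ^ 'n) set set \<Rightarrow> ('m \<Rightarrow> int ^ 'n) \<Rightarrow> 'm set \<Rightarrow> 'm set \<Rightarrow> ('m \<Rightarrow> nat) \<Rightarrow> bool" where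
  "primitive_relation \<Sigma> v I I' k \<longleftrightarrow>
     primitive_collection \<Sigma> v I \<and> spans_cone \<Sigma> v I' \<and> (\<forall>i\<in>I'. 0 < k i) \<and>
     (\<Sum>i\<in>I. v i) = (\<Sum>i\<in>I'. int (k i) *s v i)"

definition batyrev_weight_at ::
    "('m \<Rightarrow> int ^ 'n) \<Rightarrow> ('m \<Rightarrow> real) \<Rightarrow> 'm set \<Rightarrow> 'm set \<Rightarrow> ('m \<Rightarrow> nat) \<Rightarrow> real ^ 'n \<Rightarrow> real" where
  "batyrev_weight_at v lam I I' k u =
     (\<Sum>i\<in>I. ell v lam i u) - (\<Sum>i\<in>I'. real (k i) * ell v lam i u)"

text \<open>The weight of a primitive relation does not depend on the point \<open>u\<close>
  (see \<open>batyrev_weight_eq\<close> below), so it is evaluated at \<open>u = 0\<close>.\<close>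

definition batyrev_weight ::
    "('m \<Rightarrow> int ^ 'n) \<Rightarrow> ('m \<Rightarrow> real) \<Rightarrow> 'm set \<Rightarrow> 'm set \<Rightarrow> ('m \<Rightarrow> nat) \<Rightarrow> real" where
  "batyrev_weight v lam I I' k = batyrev_weight_at v lam I I' k 0"

lemma real_vec_sum: "real_vec (\<Sum>i\<in>A. f i) = (\<Sum>i\<in>A. real_vec (f i))"
  by (simp add: real_vec_def vec_eq_iff)

lemma real_vec_smult: "real_vec (a *s w) = real_of_int a *\<^sub>R real_vec w"
  by (simp add: real_vec_def vec_eq_iff)

lemma batyrev_weight_eq:
  assumes "primitive_relation \<Sigma> v I I' k"
  shows "batyrev_weight v lam I I' k = batyrev_weight_at v lam I I' k u"
proof -
  have "(\<Sum>i\<in>I. real_vec (v i)) = (\<Sum>i\<in>I'. real (k i) *\<^sub>R real_vec (v i))"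
    using assms unfolding primitive_relation_def
    by (metis (mono_tags, lifting) of_int_of_nat_eq real_vec_smult real_vec_sum sum.cong)
  then have "u \<bullet> (\<Sum>i\<in>I. real_vec (v i)) = u \<bullet> (\<Sum>i\<in>I'. real (k i) *\<^sub>R real_vec (v i))"
    by simp
  then show ?thesis
    by (simp add: batyrev_weight_def batyrev_weight_at_def ell_def sum_subtractf inner_sum_right
        right_diff_distrib sum_negf)
qed

text \<open>The pair \<open>(I', k|\<^bsub>I'\<^esub>)\<close> is uniquely determined by \<open>I\<close>, so the set below has one
  generator for each primitive collection.\<close>

definition SR_ideal ::
    "(real ^ 'n) set set \<Rightarrow> ('m \<Rightarrow> int ^ 'n) \<Rightarrow> ('m \<Rightarrow> real) \<Rightarrow> 'm zpoly set" where
  "SR_ideal \<Sigma> v lam = genideal zpoly_ring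
     {(\<Prod>i\<in>I. zvar i) - zconst (Tpow (batyrev_weight v lam I I' k)) * (\<Prod>i\<in>I'. zvar i ^ k i) | I I' k.
        primitive_relation \<Sigma> v I I' k}"

definition P_ideal :: "('m::finite \<Rightarrow> int ^ 'n) \<Rightarrow> 'm zpoly set" where
  "P_ideal v = genideal zpoly_ring (range (\<lambda>j. \<Sum>i\<in>UNIV. of_int (v i $ j) * zvar i))"

definition QH_ideal ::
    "(real ^ 'n) set set \<Rightarrow> ('m::finite \<Rightarrow> int ^ 'n) \<Rightarrow> ('m \<Rightarrow> real) \<Rightarrow> 'm zpoly set" where
  "QH_ideal \<Sigma> v lam = P_ideal v <+>\<^bsub>zpoly_ring\<^esub> SR_ideal \<Sigma> v lam"

definition QH ::
    "(real ^ 'n) set set \<Rightarrow> ('m::finite \<Rightarrow> int ^ 'n) \<Rightarrow> ('m \<Rightarrow> real) \<Rightarrow> 'm zpoly set ring" where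
  "QH \<Sigma> v lam = zpoly_ring Quot QH_ideal \<Sigma> v lam"

definition QH_class ::
    "(real ^ 'n) set set \<Rightarrow> ('m::finite \<Rightarrow> int ^ 'n) \<Rightarrow> ('m \<Rightarrow> real) \<Rightarrow> 'm zpoly \<Rightarrow> 'm zpoly set" where
  "QH_class \<Sigma> v lam p = QH_ideal \<Sigma> v lam +>\<^bsub>zpoly_ring\<^esub> p"

section \<open>The potential function and its Jacobian ring\<close>

text \<open>\<open>\<Lambda>[y\<^sub>1\<^sup>\<plusminus>,\<dots>,y\<^sub>n\<^sup>\<plusminus>]\<close>, with exponent vectors \<open>int ^ 'n\<close>.\<close>

type_synonym 'n ylaurent = "(int ^ 'n) \<Rightarrow>\<^sub>0 novikov"

definition yconst :: "novikov \<Rightarrow> 'n::finite ylaurent" where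
  "yconst c = Poly_Mapping.single 0 c"

definition ymonom :: "int ^ 'n \<Rightarrow> 'n::finite ylaurent" where
  "ymonom w = Poly_Mapping.single w 1"

abbreviation ylaurent_ring :: "'n::finite ylaurent ring" where
  "ylaurent_ring \<equiv> ring_of_type_algebra"

definition ypartial :: "'n \<Rightarrow> 'n::finite ylaurent \<Rightarrow> 'n ylaurent" where
  "ypartial j p = (\<Sum>w\<in>Poly_Mapping.keys p.
     Poly_Mapping.single (w - axis j 1) (of_int (w $ j) * Poly_Mapping.lookup p w))"

definition zbar :: "('m \<Rightarrow> int ^ 'n) \<Rightarrow> ('m \<Rightarrow> real) \<Rightarrow> real ^ 'n \<Rightarrow> 'm \<Rightarrow> 'n::finite ylaurent" where
  "zbar v lam u i = ymonom (v i) * yconst (Tpow (ell v lam i u))"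

definition PO0 :: "('m::finite \<Rightarrow> int ^ 'n) \<Rightarrow> ('m \<Rightarrow> real) \<Rightarrow> real ^ 'n \<Rightarrow> 'n::finite ylaurent" where
  "PO0 v lam u = (\<Sum>i\<in>UNIV. zbar v lam u i)"

definition Jac_ideal :: "'n::finite ylaurent \<Rightarrow> 'n ylaurent set" where
  "Jac_ideal W = genideal ylaurent_ring (range (\<lambda>j. ypartial j W))"

definition Jac :: "'n::finite ylaurent \<Rightarrow> 'n ylaurent set ring" where
  "Jac W = ylaurent_ring Quot Jac_ideal W"

definition Jac_class :: "'n::finite ylaurent \<Rightarrow> 'n ylaurent \<Rightarrow> 'n ylaurent set" where
  "Jac_class W p = Jac_ideal W +>\<^bsub>ylaurent_ring\<^esub> p"

end

theory Submission
  imports Defs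
begin

text \<open>
  Sending \<open>z\<^sub>i\<close> to \<open>zbar v lam u i\<close> defines a surjection
  \<open>\<Lambda>[z] \<rightarrow> \<Lambda>[y\<^sup>\<plusminus>]\<close>: as the fan is complete and smooth, every lattice point is a nonnegative
  combination of the generators of one cone, and this combination is unique. A primitive relation is
  a rewrite rule on monomials that preserves the image. It strictly lowers a nonnegative height that
  the moment polytope provides, so rewriting ends in the unique monomial of the same degree whose
  support spans a cone; hence the kernel is exactly the quantum Stanley--Reisner ideal. The linear
  relations are sent to \<open>y\<^sub>j \<partial>\<^sub>j\<close> of the potential, and \<open>y\<^sub>j\<close> is a unit.
\<close>

section \<open>Polynomials with Novikov coefficients\<close>

text \<open>Additive extension of a map given on single terms. Since \<open>f\<close> also receives
  the coefficient, it may twist it by an exponent-dependent factor such as a power of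
  \<open>T\<close>.\<close>

definition linear_ext :: "('a \<Rightarrow> 'b::zero \<Rightarrow> 'c::comm_monoid_add) \<Rightarrow> ('a \<Rightarrow>\<^sub>0 'b) \<Rightarrow> 'c" where
  "linear_ext f p = (\<Sum>a\<in>Poly_Mapping.keys p. f a (Poly_Mapping.lookup p a))"

lemma linear_ext_superset:
  assumes "\<And>a. f a 0 = 0" "finite A" "Poly_Mapping.keys p \<subseteq> A"
  shows "linear_ext f p = (\<Sum>a\<in>A. f a (Poly_Mapping.lookup p a))"
  unfolding linear_ext_def using assms
  by (intro sum.mono_neutral_left) (auto simp: in_keys_iff)

lemma linear_ext_single:
  assumes "\<And>a. f a 0 = 0"
  shows "linear_ext f (Poly_Mapping.single a c) = f a c"
  using linear_ext_superset[of f "{a}" "Poly_Mapping.single a c"] assms by simp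

lemma linear_ext_0: "linear_ext f 0 = 0"
  by (simp add: linear_ext_def)

lemma linear_ext_add:
  assumes "\<And>a. f a 0 = 0" "\<And>a c d. f a (c + d) = f a c + f a d"
  shows "linear_ext f (p + q) = linear_ext f p + linear_ext f q"
proof -
  let ?A = "Poly_Mapping.keys p \<union> Poly_Mapping.keys q"
  note ext = linear_ext_superset[of f ?A, OF assms(1)]
  show ?thesis
    using keys_add[of p q] by (simp add: ext lookup_add assms(2) sum.distrib)
qed

lemma linear_ext_sum:
  assumes "\<And>a. f a 0 = 0" "\<And>a c d. f a (c + d) = f a c + f a d"
  shows "linear_ext f (\<Sum>i\<in>A. p i) = (\<Sum>i\<in>A. linear_ext f (p i))"
  by (induction A rule: infinite_finite_induct)
    (simp_all add: linear_ext_0 linear_ext_add[of f, OF assms])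

text \<open>Every element is the finite sum of its terms, so an additive statement needs checking on
  single terms only.\<close>

lemma poly_mapping_induct_add [case_names zero single add]:
  assumes "P 0" "\<And>a c. P (Poly_Mapping.single a c)" "\<And>p q. P p \<Longrightarrow> P q \<Longrightarrow> P (p + q)"
  shows "P (p :: 'a \<Rightarrow>\<^sub>0 'b::comm_monoid_add)"
proof -
  have "P (\<Sum>a\<in>A. Poly_Mapping.single a (Poly_Mapping.lookup p a))" if "finite A" for A
    using that by induction (auto intro: assms)
  moreover have "(\<Sum>a\<in>Poly_Mapping.keys p. Poly_Mapping.single a (Poly_Mapping.lookup p a)) = p"
    by (rule poly_mapping_eqI)
      (simp add: lookup_sum lookup_single when_def in_keys_iff)
  ultimately show ?thesis by (metis finite_keys)
qed

text \<open>Both sides are additive in \<open>p\<close> and in \<open>q\<close>, which leaves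
  products of two single terms, where \<open>mult\<close> applies.\<close>

lemma linear_ext_mult:
  fixes f :: "'a::comm_monoid_add \<Rightarrow> 'b::comm_ring_1 \<Rightarrow> 'c::comm_ring_1"
  assumes 0: "\<And>a. f a 0 = 0" and add: "\<And>a c d. f a (c + d) = f a c + f a d"
    and mult: "\<And>a b c d. f (a + b) (c * d) = f a c * f b d"
  shows "linear_ext f (p * q) = linear_ext f p * linear_ext f q"
proof (induction p rule: poly_mapping_induct_add)
  case (single a c)
  show ?case
    by (induction q rule: poly_mapping_induct_add)
      (simp_all add: linear_ext_0 linear_ext_single[of f, OF 0] mult_single mult
        linear_ext_add[of f, OF 0 add] distrib_left)
qed (simp_all add: linear_ext_0 linear_ext_add[of f, OF 0 add] distrib_right)

section \<open>Powers of the Novikov variable\<close>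

lemma Tpow_0: "Tpow 0 = 1"
  by transfer simp

lemma Tpow_add: "Tpow (r + s) = Tpow r * Tpow s"
proof transfer
  fix r s :: real
  show "(\<lambda>x. if x = r + s then 1 else 0) =
    novikov_conv (\<lambda>x. if x = r then 1 else 0) (\<lambda>x. if x = s then 1 else 0)"
  proof
    fix z
    have "novikov_conv (\<lambda>x. if x = r then 1 else 0) (\<lambda>x. if x = s then 1 else 0) z =
        (\<Sum>a\<in>{r}. (if a = r then 1 else 0) * (if z - a = s then 1 else 0))"
      by (rule novikov_conv_superset) (auto split: if_splits)
    then show "(if z = r + s then 1 else 0) =
      novikov_conv (\<lambda>x. if x = r then 1 else 0) (\<lambda>x. if x = s then 1 else 0) z"
      by auto
  qed
qed

section \<open>Quotients of rings given by a type class\<close>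

lemma ring_of_type_algebra_simps:
  "carrier ring_of_type_algebra = UNIV"
  "x \<otimes>\<^bsub>ring_of_type_algebra\<^esub> y = x * y"
  "x \<oplus>\<^bsub>ring_of_type_algebra\<^esub> y = x + y"
  "\<one>\<^bsub>ring_of_type_algebra\<^esub> = 1"
  "\<zero>\<^bsub>ring_of_type_algebra\<^esub> = 0"
  by (simp_all add: ring_of_type_algebra_def)

text \<open>Negation is multiplication by \<open>-1\<close>, so additive inverses need no clause of
  their own. In this form ideals such as kernels and preimages are recognised by
  simplification.\<close>

lemma ideal_of_type_iff:
  "ideal I (ring_of_type_algebra :: 'a::comm_ring_1 ring) \<longleftrightarrow>
    0 \<in> I \<and> (\<forall>x\<in>I. \<forall>y\<in>I. x + y \<in> I) \<and> (\<forall>x\<in>I. \<forall>r. r * x \<in> I)" (is "?L \<longleftrightarrow> ?R")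
proof
  let ?A = "ring_of_type_algebra :: 'a ring"
  interpret A: cring ?A by (rule cring_from_type_algebra)
  show ?R if ?L
  proof -
    interpret I: ideal I ?A by fact
    show ?thesis
      using I.a_closed I.I_l_closed I.zero_closed by (auto simp: ring_of_type_algebra_simps)
  qed
  show ?L if R: ?R
  proof (rule idealI[OF ring_from_type_algebra])
    show "subgroup I (add_monoid ?A)"
    proof (rule A.add.subgroupI)
      fix a assume a: "a \<in> I"
      have "a \<oplus>\<^bsub>?A\<^esub> - a = \<zero>\<^bsub>?A\<^esub>" by (simp add: ring_of_type_algebra_simps)
      then have "\<ominus>\<^bsub>?A\<^esub> a = - a"
        by (metis A.minus_equality A.a_comm ring_of_type_algebra_simps(1) UNIV_I)
      then show "\<ominus>\<^bsub>?A\<^esub> a \<in> I" using R a by (metis mult_minus1)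
    qed (use R in \<open>auto simp: ring_of_type_algebra_simps\<close>)
  qed (use R in \<open>auto simp: ring_of_type_algebra_simps mult.commute\<close>)
qed

lemma ideal_genideal_of_type: "ideal (genideal ring_of_type_algebra S) (ring_of_type_algebra :: 'a::comm_ring_1 ring)"
  by (rule ring.genideal_ideal[OF ring_from_type_algebra]) (simp add: ring_of_type_algebra_simps)

lemma genideal_of_type_self: "S \<subseteq> genideal (ring_of_type_algebra :: 'a::comm_ring_1 ring) S"
  by (rule ring.genideal_self[OF ring_from_type_algebra]) (simp add: ring_of_type_algebra_simps)

text \<open>The first isomorphism theorem for \<open>\<phi>\<close> followed by the projection
  modulo \<open>J\<close>; by \<open>ker\<close> the kernel of this composite is
  \<open>I\<close>.\<close>

lemma quotient_ring_iso:
  fixes \<phi> :: "'a::comm_ring_1 \<Rightarrow> 'b::comm_ring_1"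
  assumes \<phi>: "\<And>p q. \<phi> (p + q) = \<phi> p + \<phi> q" "\<And>p q. \<phi> (p * q) = \<phi> p * \<phi> q" "\<phi> 1 = 1"
    and surj: "surj \<phi>"
    and J: "ideal J ring_of_type_algebra"
    and ker: "\<And>p. \<phi> p \<in> J \<longleftrightarrow> p \<in> I"
  obtains \<psi> where "\<psi> \<in> ring_iso (ring_of_type_algebra Quot I) (ring_of_type_algebra Quot J)"
    "\<And>p. \<psi> (I +>\<^bsub>ring_of_type_algebra\<^esub> p) = J +>\<^bsub>ring_of_type_algebra\<^esub> \<phi> p"
proof -
  let ?A = "ring_of_type_algebra :: 'a ring" and ?B = "ring_of_type_algebra :: 'b ring"
  interpret A: cring ?A by (rule cring_from_type_algebra)
  interpret B: cring ?B by (rule cring_from_type_algebra)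
  interpret J: ideal J ?B by (rule J)
  have \<phi>_hom: "\<phi> \<in> ring_hom ?A ?B"
    by (rule ring_hom_memI) (simp_all add: ring_of_type_algebra_simps \<phi>)
  define h where "h = (\<lambda>p. J +>\<^bsub>?B\<^esub> \<phi> p)"
  have "h \<in> ring_hom ?A (?B Quot J)"
    using ring_hom_trans[OF \<phi>_hom J.rcos_ring_hom] by (simp add: h_def comp_def)
  then interpret h: ring_hom_ring ?A "?B Quot J" h
    by (intro ring_hom_ringI2 A.ring_axioms J.quotient_is_ring)
  have mem: "J +>\<^bsub>?B\<^esub> q = J \<longleftrightarrow> q \<in> J" for q
    using J.a_rcos_const B.a_coset_join1[OF _ _ J.a_subgroup] by (auto simp: ring_of_type_algebra_simps)
  have kernel: "a_kernel ?A (?B Quot J) h = I"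
    by (auto simp: a_kernel_def' h_def FactRing_def ring_of_type_algebra_simps mem ker)
  have "carrier (?B Quot J) = range (\<lambda>q. J +>\<^bsub>?B\<^esub> q)"
    by (auto simp: FactRing_def A_RCOSETS_def' ring_of_type_algebra_simps)
  also have "\<dots> = (\<lambda>q. J +>\<^bsub>?B\<^esub> q) ` range \<phi>" using surj by simp
  finally have h_surj: "h ` carrier ?A = carrier (?B Quot J)"
    by (simp add: h_def ring_of_type_algebra_simps image_image)
  \<comment> \<open>\<open>h\<close> is constant on each coset of its kernel, so the image of a
    coset is a singleton, and its element is the value of the induced map.\<close>
  have "the_elem (h ` (I +>\<^bsub>?A\<^esub> p)) = h p" for p
    using h.the_elem_simp[of p] kernel by (simp add: ring_of_type_algebra_simps)
  with h.FactRing_iso_set[OF h_surj] show thesis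
    unfolding kernel by (intro that[of "\<lambda>Y. the_elem (h ` Y)"]) (simp_all add: h_def)
qed

section \<open>Cones of a smooth complete fan\<close>

text \<open>\<open>d b\<close> is the coordinate functional of \<open>b\<close>, represented as a
  vector through the inner product, so that lattice vectors and real vectors share one coordinate
  formula.\<close>

locale dual_lattice_basis =
  fixes B :: "(int ^ 'n::finite) set" and d :: "int ^ 'n \<Rightarrow> real ^ 'n"
  assumes finite_basis: "finite B"
    and dual: "\<And>b b'. b \<in> B \<Longrightarrow> b' \<in> B \<Longrightarrow> d b \<bullet> real_vec b' = (if b = b' then 1 else 0)"
    and expand: "\<And>x. x = (\<Sum>b\<in>B. (d b \<bullet> x) *\<^sub>R real_vec b)"
    and integral: "\<And>b w. b \<in> B \<Longrightarrow> d b \<bullet> real_vec w \<in> \<int>"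

lemma lattice_basis_imp_dual:
  fixes B :: "(int ^ 'n::finite) set"
  assumes "lattice_basis B"
  obtains d where "dual_lattice_basis B d"
proof -
  have fin: "finite B" using assms by (simp add: lattice_basis_def)
  let ?rep = "\<lambda>x c. (\<forall>b. b \<notin> B \<longrightarrow> c b = (0::int)) \<and> x = (\<Sum>b\<in>B. c b *s b)"
  have ex1: "\<exists>!c. ?rep x c" for x
    using assms by (simp add: lattice_basis_def)
  then have "\<exists>C. \<forall>x. ?rep x (C x)" by (intro choice allI ex1_implies_ex)
  then obtain C :: "int ^ 'n \<Rightarrow> int ^ 'n \<Rightarrow> int" where
    C0: "\<And>x b. b \<notin> B \<Longrightarrow> C x b = 0" and C: "\<And>x. x = (\<Sum>b\<in>B. C x b *s b)"
    by blast
  have uniq: "C x = c" if "\<And>b. b \<notin> B \<Longrightarrow> c b = 0" "x = (\<Sum>b\<in>B. c b *s b)" for x c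
  proof -
    obtain c0 where c0: "\<And>c. ?rep x c \<Longrightarrow> c = c0" using ex1[of x] by (elim ex1E) blast
    have "C x = c0" by (rule c0) (use C0 C in blast)
    moreover have "c = c0" by (rule c0) (use that in blast)
    ultimately show ?thesis by simp
  qed
  \<comment> \<open>The entries of \<open>d b\<close> are the \<open>b\<close>-coordinates of the
    standard basis vectors; once coordinates are known to be linear, pairing with \<open>d b\<close>
    reads off the \<open>b\<close>-coordinate.\<close>
  define d where "d b = (\<chi> j. real_of_int (C (axis j 1) b))" for b
  have basis_expansion_int: "(\<Sum>j\<in>UNIV. (w $ j) *s axis j 1) = w" for w :: "int ^ 'n"
    by (simp add: vec_eq_iff axis_def if_distrib cong: if_cong)
  \<comment> \<open>Linearity is forced by uniqueness: the right-hand side also represents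
    \<open>w\<close>.\<close>
  have C_lin: "C w = (\<lambda>b. \<Sum>j\<in>UNIV. w $ j * C (axis j 1) b)" for w
  proof (rule uniq)
    have "(\<Sum>b\<in>B. (\<Sum>j\<in>UNIV. w $ j * C (axis j 1) b) *s b)
        = (\<Sum>b\<in>B. \<Sum>j\<in>UNIV. (w $ j * C (axis j 1) b) *s b)"
      by (simp add: vec_eq_iff sum_distrib_right)
    also have "\<dots> = (\<Sum>j\<in>UNIV. \<Sum>b\<in>B. (w $ j * C (axis j 1) b) *s b)"
      by (rule sum.swap)
    also have "\<dots> = (\<Sum>j\<in>UNIV. (w $ j) *s (\<Sum>b\<in>B. C (axis j 1) b *s b))"
      by (simp add: vec_eq_iff sum_distrib_left mult.assoc)
    also have "\<dots> = w" using C basis_expansion_int by simp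
    finally show "w = (\<Sum>b\<in>B. (\<Sum>j\<in>UNIV. w $ j * C (axis j 1) b) *s b)" by simp
  qed (simp add: C0)
  have d_eq: "d b \<bullet> real_vec w = real_of_int (C w b)" for b w
    by (subst C_lin) (simp add: inner_vec_def d_def real_vec_def mult.commute)
  have C_basis: "C b' = (\<lambda>b. if b = b' then 1 else 0)" if "b' \<in> B" for b'
  proof (rule uniq)
    have "(\<Sum>b\<in>B. (if b = b' then 1 else 0) *s b) = (\<Sum>b\<in>B. if b = b' then b else 0)"
      by (rule sum.cong) auto
    then show "b' = (\<Sum>b\<in>B. (if b = b' then 1 else 0) *s b)"
      using fin that by simp
  qed (use that in auto)
  have "dual_lattice_basis B d"
  proof
    fix x :: "real ^ 'n"
    have 1: "real_vec (axis j 1) = (axis j 1 :: real ^ 'n)" for j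
      by (simp add: real_vec_def axis_def vec_eq_iff)
    \<comment> \<open>The standard basis vectors are integral, so their lattice expansions carry
      over; all real vectors follow by linearity.\<close>
    have 2: "axis j 1 = (\<Sum>b\<in>B. real_of_int (C (axis j 1) b) *\<^sub>R real_vec b)" for j :: 'n
      by (subst 1[symmetric], subst C[of "axis j 1"]) (simp add: real_vec_sum real_vec_smult)
    have "x = (\<Sum>j\<in>UNIV. (x $ j) *\<^sub>R axis j 1)"
      by (simp add: vec_eq_iff axis_def if_distrib cong: if_cong)
    also have "\<dots> = (\<Sum>j\<in>UNIV. \<Sum>b\<in>B. (x $ j * real_of_int (C (axis j 1) b)) *\<^sub>R real_vec b)"
      by (subst 2) (simp add: scaleR_sum_right)
    also have "\<dots> = (\<Sum>b\<in>B. \<Sum>j\<in>UNIV. (x $ j * real_of_int (C (axis j 1) b)) *\<^sub>R real_vec b)"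
      by (rule sum.swap)
    also have "\<dots> = (\<Sum>b\<in>B. (d b \<bullet> x) *\<^sub>R real_vec b)"
      by (simp add: d_def inner_vec_def scaleR_sum_left mult.commute)
    finally show "x = (\<Sum>b\<in>B. (d b \<bullet> x) *\<^sub>R real_vec b)" .
  qed (use fin in \<open>auto simp: d_eq C_basis\<close>)
  then show thesis by (rule that)
qed

section \<open>Convex cones and their faces\<close>

lemma convex_cone_sum:
  assumes "convex_cone S" "\<And>i. i \<in> A \<Longrightarrow> f i \<in> S"
  shows "(\<Sum>i\<in>A. f i) \<in> S"
  using assms(2)
  by (induction A rule: infinite_finite_induct)
    (auto intro: convex_cone_add[OF assms(1)] convex_cone_contains_0[OF assms(1)])

lemma convex_cone_hull_singleton:
  assumes "y \<in> convex_cone hull {x}"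
  obtains t where "t \<ge> 0" "y = t *\<^sub>R x"
proof -
  have "convex_cone {y. \<exists>t\<ge>0. y = t *\<^sub>R x}" unfolding convex_cone_iff
  proof (intro conjI ballI allI impI)
    fix a b assume "a \<in> {y. \<exists>t\<ge>0. y = t *\<^sub>R x}" "b \<in> {y. \<exists>t\<ge>0. y = t *\<^sub>R x}"
    then obtain s t where "s \<ge> 0" "a = s *\<^sub>R x" "t \<ge> 0" "b = t *\<^sub>R x" by auto
    then have "s + t \<ge> 0 \<and> a + b = (s + t) *\<^sub>R x" by (simp add: scaleR_add_left)
    then show "a + b \<in> {y. \<exists>t\<ge>0. y = t *\<^sub>R x}" by blast
  next
    fix a and c :: real assume "a \<in> {y. \<exists>t\<ge>0. y = t *\<^sub>R x}" "c \<ge> 0"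
    then obtain t where "t \<ge> 0" "a = t *\<^sub>R x" by auto
    then have "c * t \<ge> 0 \<and> c *\<^sub>R a = (c * t) *\<^sub>R x" using \<open>c \<ge> 0\<close> by simp
    then show "c *\<^sub>R a \<in> {y. \<exists>t\<ge>0. y = t *\<^sub>R x}" by blast
  qed (auto intro: exI[of _ 0])
  moreover have "x \<in> {y. \<exists>t\<ge>0. y = t *\<^sub>R x}" by (auto intro: exI[of _ 1])
  ultimately have "convex_cone hull {x} \<subseteq> {y. \<exists>t\<ge>0. y = t *\<^sub>R x}"
    by (intro hull_minimal) auto
  then show thesis using assms that by auto
qed

text \<open>The face property in additive form: a point of a face forces every generator that occurs
  in it with positive coefficient into that face.\<close>

lemma convex_cone_face_summand:
  assumes S: "convex_cone S" and T: "T face_of S" and x: "x \<in> S" and z: "z \<in> S"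
    and c: "c > 0" and mem: "c *\<^sub>R x + z \<in> T"
  shows "x \<in> T"
proof -
  \<comment> \<open>\<open>c x + z\<close> is the midpoint of \<open>c x\<close> and \<open>c x + 2 z\<close>, both in \<open>S\<close>.\<close>
  have cx: "c *\<^sub>R x \<in> S" using convex_cone_scaleR[OF S] c x by simp
  have "c *\<^sub>R x \<in> T"
  proof (cases "z = 0")
    case False
    have "2 *\<^sub>R z \<in> S" using convex_cone_scaleR[OF S] z by simp
    then have S2: "c *\<^sub>R x + 2 *\<^sub>R z \<in> S" using convex_cone_add[OF S cx] by simp
    have "c *\<^sub>R x + z = midpoint (c *\<^sub>R x) (c *\<^sub>R x + 2 *\<^sub>R z)"
      by (simp add: midpoint_def scaleR_add_right flip: scaleR_add_left)
    moreover have "midpoint (c *\<^sub>R x) (c *\<^sub>R x + 2 *\<^sub>R z) \<in> open_segment (c *\<^sub>R x) (c *\<^sub>R x + 2 *\<^sub>R z)"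
      using False by simp
    ultimately have "c *\<^sub>R x + z \<in> open_segment (c *\<^sub>R x) (c *\<^sub>R x + 2 *\<^sub>R z)" by simp
    then show ?thesis using face_ofD[OF T _ cx S2 mem] by blast
  qed (use mem in simp)
  \<comment> \<open>A face of a cone is again conic, so the factor \<open>c\<close> can be divided
    out.\<close>
  moreover have "conic T" using face_of_conic S T unfolding convex_cone_def by blast
  ultimately show ?thesis using c conic_mul[of T "c *\<^sub>R x" "1 / c"] by simp
qed

section \<open>Cones generated by part of a lattice basis\<close>

context dual_lattice_basis
begin

text \<open>The right-hand side is a convex cone containing the generators, and
  \<open>expand\<close> writes each of its points as a nonnegative combination of them. Membership
  thus becomes a condition on coordinates.\<close>

lemma cone_eq:
  assumes "S \<subseteq> B"
  shows "convex_cone hull (real_vec ` S) =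
    {x. (\<forall>b\<in>B. 0 \<le> d b \<bullet> x) \<and> (\<forall>b\<in>B - S. d b \<bullet> x = 0)}" (is "?L = ?R")
proof
  have "convex_cone ?R"
    by (auto simp: convex_cone_iff inner_add_right)
  moreover have "real_vec ` S \<subseteq> ?R" using assms by (auto simp: dual subset_iff)
  ultimately show "?L \<subseteq> ?R" by (intro hull_minimal)
  show "?R \<subseteq> ?L"
  proof
    fix x assume x: "x \<in> ?R"
    have "(\<Sum>b\<in>B. (d b \<bullet> x) *\<^sub>R real_vec b) \<in> ?L"
    proof (rule convex_cone_sum[OF convex_cone_convex_cone_hull])
      fix b assume b: "b \<in> B"
      show "(d b \<bullet> x) *\<^sub>R real_vec b \<in> ?L"
      proof (cases "b \<in> S")
        case True
        then show ?thesis using x b by (intro convex_cone_hull_mul hull_inc) auto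
      next
        case False
        then show ?thesis using x b by (simp add: convex_cone_hull_contains_0)
      qed
    qed
    then show "x \<in> ?L" using expand[of x] by simp
  qed
qed

lemma cone_expand:
  assumes "S \<subseteq> B" "x \<in> convex_cone hull (real_vec ` S)"
  shows "x = (\<Sum>b\<in>S. (d b \<bullet> x) *\<^sub>R real_vec b)" "\<And>b. b \<in> S \<Longrightarrow> 0 \<le> d b \<bullet> x"
proof -
  have "(\<Sum>b\<in>B. (d b \<bullet> x) *\<^sub>R real_vec b) = (\<Sum>b\<in>S. (d b \<bullet> x) *\<^sub>R real_vec b)"
    using assms finite_basis by (intro sum.mono_neutral_right) (auto simp: cone_eq)
  then show "x = (\<Sum>b\<in>S. (d b \<bullet> x) *\<^sub>R real_vec b)" using expand[of x] by simp
  show "0 \<le> d b \<bullet> x" if "b \<in> S" for b using assms that by (auto simp: cone_eq)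
qed

text \<open>The sum \<open>f\<close> of the dual vectors of the omitted generators is nonnegative on
  the large cone and vanishes exactly on the small one, so it gives a supporting hyperplane.\<close>

lemma subcone_face_of:
  assumes "S \<subseteq> B" "S' \<subseteq> S"
  shows "convex_cone hull (real_vec ` S') face_of convex_cone hull (real_vec ` S)"
proof -
  define f where "f = (\<Sum>b\<in>S - S'. d b)"
  have fin: "finite (S - S')" using assms finite_basis finite_subset by blast
  have nonneg: "0 \<le> f \<bullet> x" if "x \<in> convex_cone hull (real_vec ` S)" for x
    using that assms by (auto simp: f_def cone_eq inner_sum_left intro!: sum_nonneg)
  have "f \<bullet> x = 0 \<longleftrightarrow> (\<forall>b\<in>S - S'. d b \<bullet> x = 0)" if "x \<in> convex_cone hull (real_vec ` S)" for x
    unfolding f_def inner_sum_left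
    using that assms fin by (intro sum_nonneg_eq_0_iff) (auto simp: cone_eq)
  then have "convex_cone hull (real_vec ` S) \<inter> {x. f \<bullet> x = 0}
      = convex_cone hull (real_vec ` S) \<inter> {x. \<forall>b\<in>S - S'. d b \<bullet> x = 0}" by blast
  also have "\<dots> = convex_cone hull (real_vec ` S')"
  proof -
    have "B - S' = (B - S) \<union> (S - S')" "S' \<subseteq> B" using assms by auto
    then show ?thesis using assms(1) by (simp only: cone_eq ball_Un) blast
  qed
  finally have "convex_cone hull (real_vec ` S') = convex_cone hull (real_vec ` S) \<inter> {x. f \<bullet> x = 0}"
    by simp
  then show ?thesis
    using face_of_Int_supporting_hyperplane_ge[OF convex_convex_cone_hull, of "real_vec ` S" 0 f] nonneg
    by simp
qed

text \<open>The \<open>b\<close>-coordinate of \<open>b\<close> is 1, but it is also the gcd of the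
  entries times an integer.\<close>

lemma primitive_basis_vec:
  assumes b: "b \<in> B"
  shows "primitive_vec b"
proof -
  define g where "g = Gcd (range (\<lambda>j. b $ j))"
  have "g dvd b $ j" for j unfolding g_def by (rule Gcd_dvd) simp
  then have "\<forall>j. \<exists>k. b $ j = g * k" by (auto simp: dvd_def)
  then obtain k where k: "\<And>j. b $ j = g * k j" by metis
  then have "b = g *s (\<chi> j. k j)" by (simp add: vec_eq_iff)
  then have "1 = real_of_int g * (d b \<bullet> real_vec (\<chi> j. k j))"
    using dual[OF b b] by (metis inner_scaleR_right real_vec_smult)
  moreover obtain m where "d b \<bullet> real_vec (\<chi> j. k j) = real_of_int m"
    using integral[OF b] by (auto elim: Ints_cases)
  ultimately have "1 = real_of_int (g * m)" by simp
  then have "1 = g * m" by linarith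
  moreover have "g \<ge> 0" unfolding g_def by simp
  ultimately have "g = 1" by (metis zmult_eq_1_iff abs_1 abs_of_nonneg abs_minus_cancel)
  then show ?thesis by (simp add: primitive_vec_def g_def)
qed

end

lemma real_vec_eq_iff: "real_vec w = real_vec w' \<longleftrightarrow> w = w'"
  by (simp add: real_vec_def vec_eq_iff)

lemma primitive_vec_nonzero: "primitive_vec w \<Longrightarrow> w \<noteq> 0"
  by (auto simp: primitive_vec_def)

lemma primitive_vec_multiple:
  assumes "primitive_vec (k *s b)" "k \<ge> 0"
  shows "k = 1"
proof -
  have "k dvd Gcd (range (\<lambda>j. (k *s b) $ j))" by (rule Gcd_greatest) auto
  then show ?thesis using assms by (simp add: primitive_vec_def)
qed

section \<open>Generators of the cones of the fan\<close>

locale toric_fan =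
  fixes \<Sigma> :: "(real ^ 'n::finite) set set" and v :: "'m::finite \<Rightarrow> int ^ 'n"
  assumes fan: "smooth_complete_fan \<Sigma>" and rays: "bij_betw v UNIV (ray_generators \<Sigma>)"
begin

abbreviation cone :: "'m set \<Rightarrow> (real ^ 'n) set" where
  "cone J \<equiv> convex_cone hull ((\<lambda>i. real_vec (v i)) ` J)"

lemma cone_image: "cone J = convex_cone hull (real_vec ` v ` J)"
  by (simp add: image_image)

lemma inj_v: "v i = v j \<longleftrightarrow> i = j"
  using rays by (auto simp: bij_betw_def inj_on_def)

lemma primitive_v: "primitive_vec (v i)" and ray_in_fan: "convex_cone hull {real_vec (v i)} \<in> \<Sigma>"
  using rays by (auto simp: bij_betw_def ray_generators_def)

lemma face_in_fan: "\<sigma> \<in> \<Sigma> \<Longrightarrow> \<tau> face_of \<sigma> \<Longrightarrow> \<tau> \<noteq> {} \<Longrightarrow> \<tau> \<in> \<Sigma>"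
  using fan unfolding smooth_complete_fan_def by blast

lemma Int_face: "\<sigma> \<in> \<Sigma> \<Longrightarrow> \<tau> \<in> \<Sigma> \<Longrightarrow> (\<sigma> \<inter> \<tau>) face_of \<sigma>"
  using fan unfolding smooth_complete_fan_def by blast

text \<open>A regular cone is generated by part of a lattice basis. Each of these basis vectors is
  primitive and spans a ray that is a face, hence belongs to the fan, so it is some
  \<open>v i\<close>.\<close>

lemma fan_cone_generators:
  assumes "\<sigma> \<in> \<Sigma>"
  obtains J B d where "dual_lattice_basis B d" "v ` J \<subseteq> B" "\<sigma> = cone J"
    "\<And>i. real_vec (v i) \<in> \<sigma> \<Longrightarrow> i \<in> J"
proof -
  have "regular_cone \<sigma>" using assms fan by (auto simp: smooth_complete_fan_def)
  then obtain B S where B: "lattice_basis B" and S: "S \<subseteq> B" and \<sigma>: "\<sigma> = convex_cone hull (real_vec ` S)"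
    by (auto simp: regular_cone_def)
  obtain d where "dual_lattice_basis B d" using lattice_basis_imp_dual[OF B] .
  then interpret dual_lattice_basis B d .
  have "S \<subseteq> range v"
  proof
    fix b assume b: "b \<in> S"
    have "convex_cone hull {real_vec b} face_of \<sigma>"
      using subcone_face_of[OF S, of "{b}"] b by (simp add: \<sigma>)
    then have "convex_cone hull {real_vec b} \<in> \<Sigma>"
      by (rule face_in_fan[OF assms _ convex_cone_hull_nonempty])
    then have "b \<in> ray_generators \<Sigma>"
      using primitive_basis_vec b S by (auto simp: ray_generators_def)
    then show "b \<in> range v" using rays by (simp add: bij_betw_def)
  qed
  then obtain J where J: "S = v ` J" by (rule subset_imageE)
  \<comment> \<open>The ray of \<open>v i\<close> is its own intersection with
    \<open>\<sigma>\<close>, hence a face of \<open>\<sigma>\<close>. A basis vector with positive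
    coefficient in \<open>v i\<close> therefore lies on that ray, and primitivity makes the two
    equal.\<close>
  have "i \<in> J" if i: "real_vec (v i) \<in> \<sigma>" for i
  proof -
    let ?x = "real_vec (v i)"
    let ?\<tau> = "convex_cone hull {?x}"
    have \<tau>: "?\<tau> \<subseteq> \<sigma>" using i by (simp add: \<sigma> hull_minimal convex_cone_convex_cone_hull)
    then have face: "?\<tau> face_of \<sigma>" using Int_face[OF assms ray_in_fan[of i]] by (simp add: Int_absorb1)
    note exp = cone_expand[OF S i[unfolded \<sigma>]]
    have "?x \<noteq> 0" using primitive_vec_nonzero[OF primitive_v] by (simp add: real_vec_def vec_eq_iff)
    then obtain b where b: "b \<in> S" "d b \<bullet> ?x \<noteq> 0"
      using exp(1) by (metis (no_types, lifting) scaleR_eq_0_iff sum.neutral)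
    then have pos: "d b \<bullet> ?x > 0" using exp(2)[of b] by simp
    let ?z = "\<Sum>b'\<in>S - {b}. (d b' \<bullet> ?x) *\<^sub>R real_vec b'"
    have cc: "convex_cone \<sigma>" by (simp add: \<sigma> convex_cone_convex_cone_hull)
    have finS: "finite S" using S finite_basis finite_subset by blast
    have S_in: "real_vec b' \<in> \<sigma>" if "b' \<in> S" for b' using that by (simp add: \<sigma> hull_inc)
    have "?z \<in> \<sigma>"
      by (rule convex_cone_sum[OF cc]) (auto intro!: convex_cone_scaleR[OF cc] S_in exp(2))
    moreover have "(d b \<bullet> ?x) *\<^sub>R real_vec b + ?z = ?x"
      using exp(1) sum.remove[OF finS b(1), of "\<lambda>b. (d b \<bullet> ?x) *\<^sub>R real_vec b"] by simp
    ultimately have "real_vec b \<in> ?\<tau>"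
      using convex_cone_face_summand[OF cc face S_in[OF b(1)] _ pos] hull_inc[of ?x "{?x}"] by simp
    then obtain t where t: "real_vec b = t *\<^sub>R ?x" by (rule convex_cone_hull_singleton)
    \<comment> \<open>Pairing with \<open>d b\<close> identifies \<open>t\<close> as the inverse of
      the \<open>b\<close>-coordinate of \<open>v i\<close>; this coordinate is integral, so
      \<open>v i\<close> is an integer multiple of \<open>b\<close>.\<close>
    have "1 = t * (d b \<bullet> ?x)"
      using dual[of b b] b(1) S t by (metis inner_scaleR_right subsetD)
    then have "?x = (d b \<bullet> ?x) *\<^sub>R real_vec b" using t by (simp add: mult.commute)
    moreover obtain k where k: "d b \<bullet> ?x = real_of_int k"
      using integral[of b "v i"] b(1) S by (auto elim: Ints_cases)
    ultimately have "real_vec (v i) = real_vec (k *s b)" by (simp add: real_vec_smult)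
    then have vi: "v i = k *s b" by (simp add: real_vec_eq_iff)
    have "k \<ge> 0" using pos k by simp
    then have "k = 1" using primitive_vec_multiple primitive_v[of i] vi by metis
    then have "v i = b" using vi by (simp add: vec_eq_iff)
    then show "i \<in> J" using b(1) inj_v by (auto simp: J)
  qed
  then show thesis
    by (rule that[of B d J, rotated 3])
      (use \<open>dual_lattice_basis B d\<close> S J \<sigma> in \<open>simp_all add: image_image\<close>)
qed

text \<open>\<open>fan_cone_generators\<close> gives some index set \<open>J'\<close> with the same
  cone. It is \<open>J\<close> itself: for an index \<open>i\<close> of \<open>J'\<close> outside
  \<open>J\<close>, the \<open>v i\<close>-coordinate would vanish on \<open>cone J\<close>, yet it
  is 1 at \<open>v i\<close>.\<close>

lemma spans_coneE:
  assumes "spans_cone \<Sigma> v J"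
  obtains B d where "dual_lattice_basis B d" "v ` J \<subseteq> B" "\<And>i. real_vec (v i) \<in> cone J \<Longrightarrow> i \<in> J"
proof -
  have "cone J \<in> \<Sigma>" using assms by (simp add: spans_cone_def)
  then obtain J' B d where *: "dual_lattice_basis B d" "v ` J' \<subseteq> B" "cone J = cone J'"
    "\<And>i. real_vec (v i) \<in> cone J \<Longrightarrow> i \<in> J'"
    by (rule fan_cone_generators) (rule that)
  interpret dual_lattice_basis B d by fact
  have "J \<subseteq> J'"
  proof
    fix i assume "i \<in> J"
    then have "real_vec (v i) \<in> cone J" by (intro hull_inc imageI)
    then show "i \<in> J'" by (rule *(4))
  qed
  moreover have "J' \<subseteq> J"
  proof
    fix i assume i: "i \<in> J'"
    show "i \<in> J"
    proof (rule ccontr)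
      assume "i \<notin> J"
      then have "v i \<in> B - v ` J" using i * by (auto simp: inj_v)
      moreover have "real_vec (v i) \<in> cone J" unfolding *(3) using i by (auto intro: hull_inc)
      moreover have "v ` J \<subseteq> B" using \<open>J \<subseteq> J'\<close> * by auto
      ultimately have "d (v i) \<bullet> real_vec (v i) = 0" using cone_eq[of "v ` J"] by (simp add: image_image)
      then show False using dual[of "v i" "v i"] i * by auto
    qed
  qed
  ultimately have "J = J'" by simp
  then show thesis using * that by blast
qed

lemma spans_cone_subset:
  assumes "spans_cone \<Sigma> v J" "J' \<subseteq> J"
  shows "spans_cone \<Sigma> v J'"
proof -
  obtain B d where *: "dual_lattice_basis B d" "v ` J \<subseteq> B" using spans_coneE[OF assms(1)] .
  then interpret dual_lattice_basis B d by simp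
  have "cone J' face_of cone J" unfolding cone_image
    by (rule subcone_face_of) (use assms * in auto)
  then show ?thesis
    using face_in_fan[OF _ _ convex_cone_hull_nonempty] assms by (auto simp: spans_cone_def)
qed

section \<open>Degrees of monomials and reduced monomials\<close>

definition degree :: "('m \<Rightarrow>\<^sub>0 nat) \<Rightarrow> int ^ 'n" where
  "degree a = (\<Sum>i\<in>UNIV. int (Poly_Mapping.lookup a i) *s v i)"

text \<open>These are the standard monomials: the ones divisible by no product over a primitive
  collection.\<close>

definition reduced :: "('m \<Rightarrow>\<^sub>0 nat) \<Rightarrow> bool" where
  "reduced a \<longleftrightarrow> spans_cone \<Sigma> v (Poly_Mapping.keys a)"

lemma real_vec_degree:
  "real_vec (degree a) = (\<Sum>i\<in>Poly_Mapping.keys a. real (Poly_Mapping.lookup a i) *\<^sub>R real_vec (v i))"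
  unfolding degree_def real_vec_sum real_vec_smult
  by (intro sum.mono_neutral_cong_right) (auto simp: in_keys_iff)

text \<open>Completeness puts \<open>w\<close> into some cone of the fan, and regularity makes its
  coordinates there nonnegative integers, which serve as the exponents.\<close>

lemma reduced_exists:
  obtains a where "reduced a" "degree a = w"
proof -
  have "real_vec w \<in> \<Union>\<Sigma>" using fan by (simp add: smooth_complete_fan_def)
  then obtain \<sigma> where \<sigma>: "\<sigma> \<in> \<Sigma>" "real_vec w \<in> \<sigma>" by blast
  obtain J B d where *: "dual_lattice_basis B d" "v ` J \<subseteq> B" "\<sigma> = cone J"
    using fan_cone_generators[OF \<sigma>(1)] by metis
  then interpret dual_lattice_basis B d by simp
  have "real_vec w \<in> convex_cone hull (real_vec ` v ` J)" using \<sigma> * by (simp add: image_image)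
  note exp = cone_expand[OF *(2) this]
  have "\<exists>k. d (v i) \<bullet> real_vec w = real k" if i: "i \<in> J" for i
  proof -
    obtain k where "d (v i) \<bullet> real_vec w = real_of_int k"
      using integral[of "v i" w] i * by (auto elim: Ints_cases)
    then show ?thesis using exp(2)[of "v i"] i by (intro exI[of _ "nat k"]) auto
  qed
  then obtain k where k: "\<And>i. i \<in> J \<Longrightarrow> d (v i) \<bullet> real_vec w = real (k i)" by metis
  define a where "a = Abs_poly_mapping (\<lambda>i. if i \<in> J then k i else 0)"
  have a: "Poly_Mapping.lookup a i = (if i \<in> J then k i else 0)" for i
    unfolding a_def by (subst lookup_Abs_poly_mapping) auto
  have keys: "Poly_Mapping.keys a \<subseteq> J" by (auto simp: in_keys_iff a split: if_splits)
  have "spans_cone \<Sigma> v J" using \<sigma> * by (simp add: spans_cone_def)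
  \<comment> \<open>Coordinates may be zero, so the support of \<open>a\<close> can be smaller than
    \<open>J\<close>; it still spans a cone, namely a face.\<close>
  then have "reduced a" unfolding reduced_def using keys by (rule spans_cone_subset)
  moreover have "real_vec (degree a) = (\<Sum>i\<in>J. real (k i) *\<^sub>R real_vec (v i))"
    unfolding real_vec_degree using keys
    by (intro sum.mono_neutral_cong_left) (auto simp: in_keys_iff a)
  moreover have "real_vec w = (\<Sum>i\<in>J. real (k i) *\<^sub>R real_vec (v i))"
    by (subst exp(1), subst sum.reindex) (auto simp: k inj_on_def inj_v)
  ultimately show thesis using that by (metis real_vec_eq_iff)
qed

text \<open>The common degree lies in the intersection of the two cones, which is a face of the
  first. Being a positive combination of the generators in \<open>a\<close>, it forces all of them
  into the second cone, whose only generators are those in \<open>b\<close>.\<close>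

lemma reduced_keys_subset:
  assumes "reduced a" "reduced b" "degree a = degree b"
  shows "Poly_Mapping.keys a \<subseteq> Poly_Mapping.keys b"
proof
  fix i assume i: "i \<in> Poly_Mapping.keys a"
  let ?\<sigma> = "cone (Poly_Mapping.keys a)" and ?\<tau> = "cone (Poly_Mapping.keys b)"
  let ?f = "\<lambda>j. real (Poly_Mapping.lookup a j) *\<^sub>R real_vec (v j)"
  have cc: "convex_cone (cone J)" for J by (rule convex_cone_convex_cone_hull)
  have gen: "real c *\<^sub>R real_vec (v j) \<in> cone J" if "j \<in> J" for j J c
    using that by (intro convex_cone_hull_mul hull_inc imageI) auto
  have deg: "real_vec (degree c) \<in> cone (Poly_Mapping.keys c)" for c
    unfolding real_vec_degree by (intro convex_cone_sum[OF cc] gen)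
  have face: "(?\<sigma> \<inter> ?\<tau>) face_of ?\<sigma>"
    using assms(1,2) by (auto simp: reduced_def spans_cone_def intro: Int_face)
  have vi: "real_vec (v i) \<in> ?\<sigma>" using i by (auto intro: hull_inc)
  let ?z = "\<Sum>j\<in>Poly_Mapping.keys a - {i}. ?f j"
  have z: "?z \<in> ?\<sigma>" by (intro convex_cone_sum[OF cc] gen) auto
  have "?f i + ?z = real_vec (degree a)"
    unfolding real_vec_degree using sum.remove[OF _ i, of ?f] by simp
  then have "?f i + ?z \<in> ?\<sigma> \<inter> ?\<tau>" using deg[of a] deg[of b] assms(3) by simp
  moreover have "real (Poly_Mapping.lookup a i) > 0" using i by (simp add: in_keys_iff)
  ultimately have "real_vec (v i) \<in> ?\<tau>"
    using convex_cone_face_summand[OF cc face vi z] by blast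
  then show "i \<in> Poly_Mapping.keys b"
    using spans_coneE[of "Poly_Mapping.keys b"] assms(2) unfolding reduced_def by metis
qed

text \<open>Once the supports agree, both exponent vectors list the coordinates of the same degree
  in one lattice basis.\<close>

lemma reduced_unique:
  assumes "reduced a" "reduced b" "degree a = degree b"
  shows "a = b"
proof (rule poly_mapping_eqI)
  have keys: "Poly_Mapping.keys a = Poly_Mapping.keys b"
    using reduced_keys_subset assms by (metis subset_antisym)
  let ?J = "Poly_Mapping.keys a"
  obtain B d where *: "dual_lattice_basis B d" "v ` ?J \<subseteq> B"
    using spans_coneE assms(1) unfolding reduced_def by metis
  then interpret dual_lattice_basis B d by simp
  fix i
  show "Poly_Mapping.lookup a i = Poly_Mapping.lookup b i"
  proof (cases "i \<in> ?J")
    case True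
    have coeff: "d (v i) \<bullet> real_vec (degree c) = real (Poly_Mapping.lookup c i)"
      if c: "Poly_Mapping.keys c = ?J" for c
    proof -
      have "d (v i) \<bullet> real_vec (degree c)
          = (\<Sum>j\<in>?J. real (Poly_Mapping.lookup c j) * (d (v i) \<bullet> real_vec (v j)))"
        by (simp add: real_vec_degree c inner_sum_right)
      also have "\<dots> = (\<Sum>j\<in>?J. if i = j then real (Poly_Mapping.lookup c j) else 0)"
        using True * by (intro sum.cong) (auto simp: dual inj_v image_subset_iff)
      finally show ?thesis using True by simp
    qed
    show ?thesis using coeff[OF refl] coeff[OF keys[symmetric]] assms(3) by simp
  next
    case False
    then show ?thesis using keys by (metis in_keys_iff)
  qed
qed

section \<open>Primitive collections and their relations\<close>

lemma ex_primitive_collection_subset: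
  assumes "\<not> spans_cone \<Sigma> v J"
  obtains I where "I \<subseteq> J" "primitive_collection \<Sigma> v I"
proof -
  have "finite J" by simp
  then have "\<exists>I\<subseteq>J. primitive_collection \<Sigma> v I" using assms
  proof (induction J rule: finite_psubset_induct)
    case (psubset J)
    show ?case
    proof (cases "primitive_collection \<Sigma> v J")
      case False
      then obtain K where "K \<subset> J" "\<not> spans_cone \<Sigma> v K"
        using psubset.prems by (auto simp: primitive_collection_def)
      then show ?thesis using psubset.IH[of K] by blast
    qed blast
  qed
  then show thesis using that by blast
qed

text \<open>The right-hand side of the relation is the reduced monomial whose degree is the sum of
  the \<open>v i\<close> over \<open>I\<close>.\<close>

lemma ex_primitive_relation:
  assumes "primitive_collection \<Sigma> v I"
  obtains I' k where "primitive_relation \<Sigma> v I I' k"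
proof -
  obtain a where a: "reduced a" "degree a = (\<Sum>i\<in>I. v i)" by (rule reduced_exists)
  have "(\<Sum>i\<in>Poly_Mapping.keys a. int (Poly_Mapping.lookup a i) *s v i) = degree a"
    unfolding degree_def by (intro sum.mono_neutral_left) (auto simp: in_keys_iff)
  then have "primitive_relation \<Sigma> v I (Poly_Mapping.keys a) (Poly_Mapping.lookup a)"
    using assms a by (auto simp: primitive_relation_def reduced_def in_keys_iff)
  then show thesis by (rule that)
qed

lemma primitive_relation_inner:
  assumes "primitive_relation \<Sigma> v I I' k"
  shows "(\<Sum>i\<in>I. x \<bullet> real_vec (v i)) = (\<Sum>i\<in>I'. real (k i) * (x \<bullet> real_vec (v i)))"
proof -
  have "real_vec (\<Sum>i\<in>I. v i) = real_vec (\<Sum>i\<in>I'. int (k i) *s v i)"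
    using assms by (simp add: primitive_relation_def)
  then have "x \<bullet> real_vec (\<Sum>i\<in>I. v i) = x \<bullet> real_vec (\<Sum>i\<in>I'. int (k i) *s v i)" by simp
  then show ?thesis by (simp add: real_vec_sum real_vec_smult inner_sum_right)
qed

text \<open>
  The height of \<open>i\<close> is the distance of \<open>v\<^sub>i\<close> at a point of \<open>P\<close> from its actual minimum over \<open>P\<close>,
  not from \<open>lam i\<close>; this avoids showing that every inequality \<open>\<ell>\<^sub>i \<ge> 0\<close> is tight.
\<close>

lemma ex_height:
  assumes P: "normal_fan P = \<Sigma>"
  obtains h :: "'m \<Rightarrow> real" where "\<And>i. 0 \<le> h i"
    "\<And>I I' k. primitive_relation \<Sigma> v I I' k \<Longrightarrow> (\<Sum>i\<in>I'. real (k i) * h i) < (\<Sum>i\<in>I. h i)"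
proof -
  have fan_faceE: "\<exists>F. \<sigma> = normal_cone P F \<and> F \<subseteq> P \<and> F \<noteq> {}" if "\<sigma> \<in> \<Sigma>" for \<sigma>
    using that P by (auto simp: normal_fan_def dest: face_of_imp_subset)
  \<comment> \<open>The ray of \<open>v i\<close> is the normal cone of a nonempty face, and
    \<open>v i\<close> attains its minimum over \<open>P\<close> there.\<close>
  have "\<exists>y\<in>P. \<forall>x\<in>P. y \<bullet> real_vec (v i) \<le> x \<bullet> real_vec (v i)" for i
  proof -
    obtain F where F: "convex_cone hull {real_vec (v i)} = normal_cone P F" "F \<subseteq> P" "F \<noteq> {}"
      using fan_faceE[OF ray_in_fan] by blast
    then have "real_vec (v i) \<in> normal_cone P F" using hull_inc[of "real_vec (v i)"] by auto
    then show ?thesis using F by (fastforce simp: normal_cone_def inner_commute)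
  qed
  then obtain y where y: "\<And>i. y i \<in> P"
    and y_min: "\<And>i x. x \<in> P \<Longrightarrow> y i \<bullet> real_vec (v i) \<le> x \<bullet> real_vec (v i)" by metis
  define N where "N x i = x \<bullet> real_vec (v i) - y i \<bullet> real_vec (v i)" for x i
  have N_nonneg: "0 \<le> N x i" if "x \<in> P" for x i using y_min[OF that] by (simp add: N_def)
  obtain x0 where x0: "x0 \<in> P" using y by blast
  show thesis
  proof (rule that[of "N x0"])
    fix I I' k assume rel: "primitive_relation \<Sigma> v I I' k"
    \<comment> \<open>Pairing the relation with a point shows that the drop in height is the same at
      every point. It can thus be evaluated on the face \<open>F\<close> belonging to
      \<open>I'\<close> instead of at \<open>x0\<close>.\<close>
    have N_diff: "(\<Sum>i\<in>I. N x i) - (\<Sum>i\<in>I'. real (k i) * N x i)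
        = (\<Sum>i\<in>I. N x0 i) - (\<Sum>i\<in>I'. real (k i) * N x0 i)" for x
      using primitive_relation_inner[OF rel, of x] primitive_relation_inner[OF rel, of x0]
      by (simp add: N_def sum_subtractf right_diff_distrib)
    have I': "spans_cone \<Sigma> v I'" and I: "\<not> spans_cone \<Sigma> v I"
      using rel by (auto simp: primitive_relation_def primitive_collection_def)
    obtain F where F: "cone I' = normal_cone P F" "F \<subseteq> P" "F \<noteq> {}"
      using fan_faceE[of "cone I'"] I' by (auto simp: spans_cone_def)
    have N_I': "N x i = 0" if "x \<in> F" "i \<in> I'" for x i
    proof -
      have "real_vec (v i) \<in> normal_cone P F" unfolding F(1)[symmetric] using that by (auto intro: hull_inc)
      then have "real_vec (v i) \<bullet> x \<le> real_vec (v i) \<bullet> y i"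
        using that y by (simp add: normal_cone_def)
      then show ?thesis using N_nonneg[of x i] that F by (auto simp: N_def inner_commute)
    qed
    \<comment> \<open>Otherwise \<open>I\<close> would span a cone, as a subset of
      \<open>I'\<close>. An index outside \<open>I'\<close> has its generator outside
      \<open>cone I'\<close>.\<close>
    have "\<not> I \<subseteq> I'" using I I' spans_cone_subset by blast
    then obtain i where i: "i \<in> I" "i \<notin> I'" by blast
    then have "real_vec (v i) \<notin> normal_cone P F"
      using spans_coneE[OF I'] F(1) by metis
    \<comment> \<open>Outside the normal cone, \<open>v i\<close> fails to be minimal at some
      \<open>x\<close> of \<open>F\<close>. At this \<open>x\<close> the \<open>I\<close>-side is
      positive, while the \<open>I'\<close>-side is zero.\<close>
    then obtain x z where xz: "x \<in> F" "z \<in> P" "real_vec (v i) \<bullet> z < real_vec (v i) \<bullet> x"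
      by (auto simp: normal_cone_def not_le)
    have "0 < N x i" using xz y_min[OF xz(2), of i] by (simp add: N_def inner_commute)
    also have "N x i \<le> (\<Sum>i\<in>I. N x i)"
      using i xz F N_nonneg by (intro member_le_sum) auto
    also have "\<dots> = (\<Sum>i\<in>I. N x i) - (\<Sum>i\<in>I'. real (k i) * N x i)"
      using xz by (simp add: N_I')
    finally show "(\<Sum>i\<in>I'. real (k i) * N x0 i) < (\<Sum>i\<in>I. N x0 i)"
      unfolding N_diff[of x] by simp
  qed (rule N_nonneg[OF x0])
qed

end

section \<open>The kernel of the map to Laurent polynomials\<close>

text \<open>Used in two ways: with the height that makes rewriting terminate, and with the values
  \<open>ell v lam i u\<close>, where it is the power of \<open>T\<close> that a monomial
  acquires.\<close>

definition weight :: "('m::finite \<Rightarrow> real) \<Rightarrow> ('m \<Rightarrow>\<^sub>0 nat) \<Rightarrow> real" where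
  "weight h a = (\<Sum>i\<in>UNIV. real (Poly_Mapping.lookup a i) * h i)"

lemma weight_0: "weight h 0 = 0"
  by (simp add: weight_def)

lemma weight_add: "weight h (a + b) = weight h a + weight h b"
  by (simp add: weight_def lookup_add distrib_right sum.distrib)

definition exponent :: "'m set \<Rightarrow> ('m \<Rightarrow> nat) \<Rightarrow> 'm \<Rightarrow>\<^sub>0 nat" where
  "exponent I k = (\<Sum>i\<in>I. Poly_Mapping.single i (k i))"

lemma lookup_exponent:
  fixes I :: "'m::finite set"
  shows "Poly_Mapping.lookup (exponent I k) i = (if i \<in> I then k i else 0)"
  by (simp add: exponent_def lookup_sum lookup_single when_def)

lemma weight_exponent: "weight h (exponent I k) = (\<Sum>i\<in>I. real (k i) * h i)"
  unfolding weight_def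
  by (intro sum.mono_neutral_cong_right) (auto simp: lookup_exponent)

lemma zvar_power: "zvar i ^ k = Poly_Mapping.single (Poly_Mapping.single i k) 1"
  by (induction k) (simp_all add: zvar_def mult_single flip: single_add)

lemma prod_zvar_power: "(\<Prod>i\<in>I. zvar i ^ k i) = Poly_Mapping.single (exponent I k) 1"
  unfolding exponent_def
  by (induction I rule: infinite_finite_induct) (simp_all add: zvar_power mult_single)

context toric_fan
begin

lemma degree_0: "degree 0 = 0"
  by (simp add: degree_def)

lemma degree_add: "degree (a + b) = degree a + degree b"
  by (simp add: degree_def lookup_add vector_sadd_rdistrib sum.distrib)

lemma degree_exponent: "degree (exponent I k) = (\<Sum>i\<in>I. int (k i) *s v i)"
  unfolding degree_def
  by (intro sum.mono_neutral_cong_right) (auto simp: lookup_exponent)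

end

section \<open>The substitution homomorphism\<close>

locale toric_potential = toric_fan \<Sigma> v
  for \<Sigma> :: "(real ^ 'n::finite) set set" and v :: "'m::finite \<Rightarrow> int ^ 'n" +
  fixes lam :: "'m \<Rightarrow> real" and u :: "real ^ 'n"
begin

abbreviation energy :: "('m \<Rightarrow>\<^sub>0 nat) \<Rightarrow> real" where
  "energy \<equiv> weight (\<lambda>i. ell v lam i u)"

text \<open>The substitution of \<open>zbar v lam u i\<close> for \<open>zvar i\<close>, written out
  on monomials: the degree is the resulting exponent of \<open>y\<close>, the energy that of
  \<open>T\<close>.\<close>

definition zbar_hom :: "'m zpoly \<Rightarrow> 'n ylaurent" where
  "zbar_hom = linear_ext (\<lambda>a c. Poly_Mapping.single (degree a) (c * Tpow (energy a)))"

lemma zbar_hom_single: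
  "zbar_hom (Poly_Mapping.single a c) = Poly_Mapping.single (degree a) (c * Tpow (energy a))"
  unfolding zbar_hom_def by (rule linear_ext_single) simp

lemma zbar_hom_add: "zbar_hom (p + q) = zbar_hom p + zbar_hom q"
  unfolding zbar_hom_def by (rule linear_ext_add) (simp_all add: distrib_right single_add)

lemma zbar_hom_sum: "zbar_hom (\<Sum>i\<in>A. p i) = (\<Sum>i\<in>A. zbar_hom (p i))"
  unfolding zbar_hom_def by (rule linear_ext_sum) (simp_all add: distrib_right single_add)

lemma zbar_hom_mult: "zbar_hom (p * q) = zbar_hom p * zbar_hom q"
  unfolding zbar_hom_def
  by (rule linear_ext_mult)
    (simp_all add: distrib_right single_add mult_single degree_add weight_add Tpow_add mult_ac)

lemma zbar_hom_zconst: "zbar_hom (zconst c) = yconst c"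
  by (simp add: zconst_def yconst_def zbar_hom_single degree_0 weight_0 Tpow_0)

lemma zbar_hom_0: "zbar_hom 0 = 0"
  by (simp add: zbar_hom_def linear_ext_0)

lemma zbar_hom_1: "zbar_hom 1 = 1"
  using zbar_hom_zconst[of 1] by (simp add: zconst_def yconst_def)

lemma zbar_hom_of_int: "zbar_hom (of_int n) = of_int n"
  using zbar_hom_zconst[of "of_int n"] by (simp add: zconst_def yconst_def)

lemma zbar_hom_diff: "zbar_hom (p - q) = zbar_hom p - zbar_hom q"
  using zbar_hom_add[of "p - q" q] by simp

lemma zbar_single: "zbar v lam u i = Poly_Mapping.single (v i) (Tpow (ell v lam i u))"
  by (simp add: zbar_def ymonom_def yconst_def mult_single)

lemma zbar_hom_zvar: "zbar_hom (zvar i) = zbar v lam u i"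
proof -
  have "Poly_Mapping.single i (1::nat) = exponent {i} (\<lambda>_. 1)" by (simp add: exponent_def)
  then show ?thesis
    by (simp add: zvar_def zbar_hom_single degree_exponent weight_exponent zbar_single)
qed

section \<open>The quantum Stanley-Reisner ideal\<close>

lemma SR_ideal: "ideal (SR_ideal \<Sigma> v lam) zpoly_ring"
  unfolding SR_ideal_def by (rule ideal_genideal_of_type)

lemma SR_add: "p \<in> SR_ideal \<Sigma> v lam \<Longrightarrow> q \<in> SR_ideal \<Sigma> v lam \<Longrightarrow> p + q \<in> SR_ideal \<Sigma> v lam"
  using SR_ideal unfolding ideal_of_type_iff by blast

lemma SR_mult: "p \<in> SR_ideal \<Sigma> v lam \<Longrightarrow> r * p \<in> SR_ideal \<Sigma> v lam"
  using SR_ideal unfolding ideal_of_type_iff by blast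

lemma SR_0: "0 \<in> SR_ideal \<Sigma> v lam"
  using SR_ideal unfolding ideal_of_type_iff by blast

lemma SR_generator:
  "(\<Prod>i\<in>I. zvar i) - zconst c * (\<Prod>i\<in>I'. zvar i ^ k i) =
    Poly_Mapping.single (exponent I (\<lambda>_. 1)) 1 - Poly_Mapping.single (exponent I' k) c"
  using prod_zvar_power[of "\<lambda>_. 1" I]
  by (simp add: prod_zvar_power zconst_def mult_single)

text \<open>The weight may be evaluated at any point; at \<open>u\<close> it becomes a difference of
  energies, which is what makes the binomials vanish under \<open>zbar_hom\<close>.\<close>

lemma batyrev_weight_energy:
  assumes "primitive_relation \<Sigma> v I I' k"
  shows "batyrev_weight v lam I I' k = energy (exponent I (\<lambda>_. 1)) - energy (exponent I' k)"
  unfolding batyrev_weight_eq[OF assms, of _ u] by (simp add: batyrev_weight_at_def weight_exponent)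

lemma primitive_relation_degree:
  "primitive_relation \<Sigma> v I I' k \<Longrightarrow> degree (exponent I (\<lambda>_. 1)) = degree (exponent I' k)"
  by (simp add: primitive_relation_def degree_exponent)

text \<open>A generator times the term with exponent \<open>a\<close> and coefficient
  \<open>c\<close>: one rewriting step inside a larger monomial.\<close>

lemma SR_step:
  assumes "primitive_relation \<Sigma> v I I' k"
  shows "Poly_Mapping.single (a + exponent I (\<lambda>_. 1)) c -
    Poly_Mapping.single (a + exponent I' k) (c * Tpow (batyrev_weight v lam I I' k)) \<in> SR_ideal \<Sigma> v lam"
proof -
  let ?w = "batyrev_weight v lam I I' k"
  have "(\<Prod>i\<in>I. zvar i) - zconst (Tpow ?w) * (\<Prod>i\<in>I'. zvar i ^ k i) \<in> SR_ideal \<Sigma> v lam"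
    unfolding SR_ideal_def using assms by (intro subsetD[OF genideal_of_type_self]) blast
  from SR_mult[OF this, of "Poly_Mapping.single a c"] show ?thesis
    by (simp add: SR_generator right_diff_distrib mult_single)
qed

text \<open>The kernel is an ideal, so generators suffice; the two monomials of a generator have
  equal degree, and the Batyrev weight makes up for their different energies.\<close>

lemma zbar_hom_SR:
  assumes "p \<in> SR_ideal \<Sigma> v lam"
  shows "zbar_hom p = 0"
proof -
  have "ideal {p. zbar_hom p = 0} zpoly_ring"
    by (simp add: ideal_of_type_iff zbar_hom_0 zbar_hom_add zbar_hom_mult)
  moreover have "zbar_hom ((\<Prod>i\<in>I. zvar i) - zconst (Tpow (batyrev_weight v lam I I' k)) * (\<Prod>i\<in>I'. zvar i ^ k i)) = 0"
    if "primitive_relation \<Sigma> v I I' k" for I I' k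
    using that
    by (simp add: SR_generator zbar_hom_diff zbar_hom_single batyrev_weight_energy
        primitive_relation_degree[simplified] flip: Tpow_add)
  ultimately have "SR_ideal \<Sigma> v lam \<subseteq> {p. zbar_hom p = 0}"
    unfolding SR_ideal_def by (intro ring.genideal_minimal[OF ring_from_type_algebra]) auto
  then show ?thesis using assms by blast
qed

text \<open>Repeated rewriting by primitive relations. The power of \<open>T\<close> is the one for
  which both terms have the same image under \<open>zbar_hom\<close>.\<close>

lemma SR_reduction:
  assumes P: "normal_fan P = \<Sigma>"
  obtains b where "reduced b" "degree b = degree a"
    "\<And>c. Poly_Mapping.single a c - Poly_Mapping.single b (c * Tpow (energy a - energy b)) \<in> SR_ideal \<Sigma> v lam"
proof -
  obtain h where h_nonneg: "\<And>i. 0 \<le> h i"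
    and h: "\<And>I I' k. primitive_relation \<Sigma> v I I' k \<Longrightarrow> (\<Sum>i\<in>I'. real (k i) * h i) < (\<Sum>i\<in>I. h i)"
    using ex_height[OF P] by blast
  \<comment> \<open>Heights are real numbers, so strict decrease alone does not end the rewriting.
    Fixing one relation for each of the finitely many primitive collections yields a uniform least
    drop.\<close>
  have "\<forall>I. \<exists>I' k. primitive_collection \<Sigma> v I \<longrightarrow> primitive_relation \<Sigma> v I I' k"
    using ex_primitive_relation by blast
  then obtain R K where rel: "\<And>I. primitive_collection \<Sigma> v I \<Longrightarrow> primitive_relation \<Sigma> v I (R I) (K I)"
    by metis
  define gap where "gap I = weight h (exponent I (\<lambda>_. 1)) - weight h (exponent (R I) (K I))" for I
  \<comment> \<open>The extra 1 keeps the set nonempty when there are no primitive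
    collections.\<close>
  define \<epsilon> where "\<epsilon> = Min (insert 1 (gap ` {I. primitive_collection \<Sigma> v I}))"
  have gap_pos: "0 < gap I" if "primitive_collection \<Sigma> v I" for I
    using h[OF rel[OF that]] by (simp add: gap_def weight_exponent)
  have \<epsilon>_pos: "0 < \<epsilon>" using gap_pos by (auto simp: \<epsilon>_def)
  have \<epsilon>_le: "\<epsilon> \<le> gap I" if "primitive_collection \<Sigma> v I" for I
    unfolding \<epsilon>_def using that by (intro Min_le) auto
  have red: "\<exists>b. reduced b \<and> degree b = degree a \<and>
      (\<forall>c. Poly_Mapping.single a c - Poly_Mapping.single b (c * Tpow (energy a - energy b)) \<in> SR_ideal \<Sigma> v lam)"
    if "weight h a < real n * \<epsilon>" for n a
    using that
  proof (induction n arbitrary: a)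
    \<comment> \<open>Weights are nonnegative, so this case is vacuous.\<close>
    case 0
    have "0 \<le> weight h a" unfolding weight_def using h_nonneg by (intro sum_nonneg) simp
    then show ?case using 0 by simp
  next
    case (Suc n)
    show ?case
    proof (cases "reduced a")
      case True
      then show ?thesis by (intro exI[of _ a]) (simp add: Tpow_0 SR_0)
    next
      case False
      then obtain I where I: "I \<subseteq> Poly_Mapping.keys a" "primitive_collection \<Sigma> v I"
        using ex_primitive_collection_subset unfolding reduced_def by metis
      let ?e = "exponent I (\<lambda>_. 1)" and ?e' = "exponent (R I) (K I)"
      define a0 where "a0 = a - ?e"
      \<comment> \<open>Subtraction of exponents truncates at zero, but every index of
        \<open>I\<close> has a positive exponent in \<open>a\<close>, so nothing is lost.\<close>
      have a: "a = a0 + ?e"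
      proof (rule poly_mapping_eqI)
        fix i
        have "i \<in> I \<Longrightarrow> Poly_Mapping.lookup a i \<noteq> 0" using I(1) by (auto simp: in_keys_iff)
        then show "Poly_Mapping.lookup a i = Poly_Mapping.lookup (a0 + ?e) i"
          by (auto simp: a0_def lookup_add lookup_minus lookup_exponent)
      qed
      note rel = rel[OF I(2)]
      let ?a' = "a0 + ?e'"
      let ?w = "batyrev_weight v lam I (R I) (K I)"
      have "weight h ?a' = weight h a - gap I" by (simp add: a weight_add gap_def)
      then have "weight h ?a' < real n * \<epsilon>"
        using Suc.prems \<epsilon>_le[OF I(2)] by (simp add: distrib_right)
      from Suc.IH[OF this] obtain b where b: "reduced b" "degree b = degree ?a'"
        "\<And>c. Poly_Mapping.single ?a' c - Poly_Mapping.single b (c * Tpow (energy ?a' - energy b)) \<in> SR_ideal \<Sigma> v lam"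
        by blast
      have w: "energy a - energy b = ?w + (energy ?a' - energy b)"
        unfolding batyrev_weight_energy[OF rel] by (simp add: a weight_add)
      have "degree b = degree a"
        using b(2) primitive_relation_degree[OF rel] by (simp add: a degree_add)
      \<comment> \<open>The two differences telescope: the induction hypothesis is applied to the
        coefficient that the step produces, hence the quantification over all coefficients.\<close>
      moreover have "Poly_Mapping.single a c - Poly_Mapping.single b (c * Tpow (energy a - energy b)) \<in> SR_ideal \<Sigma> v lam" for c
        using SR_add[OF SR_step[OF rel, of a0 c] b(3)[of "c * Tpow ?w"]]
        unfolding a[symmetric] by (simp add: w Tpow_add mult.assoc)
      ultimately show ?thesis using b(1) by blast
    qed
  qed
  obtain n where "weight h a < real n * \<epsilon>" using reals_Archimedean3[OF \<epsilon>_pos] by blast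
  from red[OF this] that show thesis by blast
qed

text \<open>The choice is unambiguous by \<open>reduced_unique\<close>.\<close>

definition normal_form :: "int ^ 'n \<Rightarrow> 'm \<Rightarrow>\<^sub>0 nat" where
  "normal_form w = (SOME a. reduced a \<and> degree a = w)"

lemma normal_form: "reduced (normal_form w)" "degree (normal_form w) = w"
proof -
  have "\<exists>a. reduced a \<and> degree a = w" using reduced_exists by metis
  from someI_ex[OF this] show "reduced (normal_form w)" "degree (normal_form w) = w"
    by (simp_all add: normal_form_def)
qed

text \<open>An additive section of \<open>zbar_hom\<close>; the negative energy cancels the power of
  \<open>T\<close> acquired by the normal form.\<close>

definition lift_monomials :: "'n ylaurent \<Rightarrow> 'm zpoly" where
  "lift_monomials = linear_ext (\<lambda>w c. Poly_Mapping.single (normal_form w) (c * Tpow (- energy (normal_form w))))"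

lemma lift_monomials_single:
  "lift_monomials (Poly_Mapping.single w c) =
    Poly_Mapping.single (normal_form w) (c * Tpow (- energy (normal_form w)))"
  unfolding lift_monomials_def by (rule linear_ext_single) simp

lemma lift_monomials_add: "lift_monomials (p + q) = lift_monomials p + lift_monomials q"
  unfolding lift_monomials_def by (rule linear_ext_add) (simp_all add: distrib_right single_add)

lemma lift_monomials_0: "lift_monomials 0 = 0"
  by (simp add: lift_monomials_def linear_ext_0)

lemma zbar_hom_lift: "zbar_hom (lift_monomials q) = q"
proof (induction q rule: poly_mapping_induct_add)
  case (single w c)
  then show ?case
    by (simp add: lift_monomials_single zbar_hom_single normal_form mult.assoc Tpow_0 flip: Tpow_add)
qed (simp_all add: lift_monomials_0 zbar_hom_0 lift_monomials_add zbar_hom_add)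

lemma surj_zbar_hom: "surj zbar_hom"
  using zbar_hom_lift by (rule surjI)

text \<open>By additivity a single term suffices. Its reduction has the same degree and is reduced,
  so it is the normal form chosen by the section. Hence an element with zero image lies in the
  ideal.\<close>

lemma lift_zbar_hom_SR:
  assumes P: "normal_fan P = \<Sigma>"
  shows "p - lift_monomials (zbar_hom p) \<in> SR_ideal \<Sigma> v lam"
proof (induction p rule: poly_mapping_induct_add)
  case zero
  then show ?case by (simp add: zbar_hom_0 lift_monomials_0 SR_0)
next
  case (single a c)
  obtain b where b: "reduced b" "degree b = degree a"
    "Poly_Mapping.single a c - Poly_Mapping.single b (c * Tpow (energy a - energy b)) \<in> SR_ideal \<Sigma> v lam"
    using SR_reduction[OF P] by metis
  have "normal_form (degree a) = b"
    using normal_form b by (intro reduced_unique) auto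
  then show ?case using b(3)
    by (simp add: zbar_hom_single lift_monomials_single mult.assoc flip: Tpow_add)
next
  case (add p q)
  then show ?case using SR_add by (fastforce simp: zbar_hom_add lift_monomials_add add_diff_add)
qed

lemma zbar_hom_eq_0_iff:
  assumes "normal_fan P = \<Sigma>"
  shows "zbar_hom p = 0 \<longleftrightarrow> p \<in> SR_ideal \<Sigma> v lam"
  using lift_zbar_hom_SR[OF assms, of p] zbar_hom_SR by (auto simp: lift_monomials_0)

section \<open>Linear relations and partial derivatives\<close>

lemma of_int_mult_single: "of_int n * Poly_Mapping.single w c = Poly_Mapping.single w (of_int n * c)"
  by (simp add: mult_single flip: single_of_int)

text \<open>Each \<open>zbar v lam u i\<close> is an eigenvector of \<open>y_j d/dy_j\<close> with
  eigenvalue \<open>v i $ j\<close>; the monomial in front divides by \<open>y_j\<close>.\<close>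

lemma ypartial_PO0:
  "ypartial j (PO0 v lam u) =
    ymonom (- axis j 1) * zbar_hom (\<Sum>i\<in>UNIV. of_int (v i $ j) * zvar i)"
proof -
  \<comment> \<open>As a \<open>linear_ext\<close>, the derivative is additive, so the support of
    the potential need not be computed.\<close>
  have "ypartial j (PO0 v lam u) = linear_ext
      (\<lambda>w c. Poly_Mapping.single (w - axis j 1) (of_int (w $ j) * c)) (\<Sum>i\<in>UNIV. zbar v lam u i)"
    by (simp add: PO0_def ypartial_def linear_ext_def)
  also have "\<dots> = (\<Sum>i\<in>UNIV. Poly_Mapping.single (v i - axis j 1) (of_int (v i $ j) * Tpow (ell v lam i u)))"
    by (subst linear_ext_sum) (simp_all add: zbar_single linear_ext_single distrib_left single_add)
  also have "\<dots> = (\<Sum>i\<in>UNIV. ymonom (- axis j 1) * (of_int (v i $ j) * zbar v lam u i))"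
    by (simp add: ymonom_def zbar_single of_int_mult_single mult_single)
  also have "\<dots> = ymonom (- axis j 1) * zbar_hom (\<Sum>i\<in>UNIV. of_int (v i $ j) * zvar i)"
    by (simp add: zbar_hom_sum sum_distrib_left zbar_hom_mult zbar_hom_of_int zbar_hom_zvar)
  finally show ?thesis .
qed

lemma ymonom_mult_inverse: "ymonom w * ymonom (- w) = 1"
  by (simp add: ymonom_def mult_single)

lemma zbar_hom_ideal_iff:
  assumes P: "normal_fan P = \<Sigma>"
  shows "zbar_hom p \<in> Jac_ideal (PO0 v lam u) \<longleftrightarrow> p \<in> QH_ideal \<Sigma> v lam"
proof -
  let ?J = "Jac_ideal (PO0 v lam u)" and ?Q = "QH_ideal \<Sigma> v lam"
  let ?g = "\<lambda>j. \<Sum>i\<in>UNIV. of_int (v i $ j) * zvar i"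
  have J: "ideal ?J ylaurent_ring" unfolding Jac_ideal_def by (rule ideal_genideal_of_type)
  have PI: "ideal (P_ideal v) (zpoly_ring :: 'm zpoly ring)"
    unfolding P_ideal_def by (rule ideal_genideal_of_type)
  have Q: "ideal ?Q zpoly_ring"
    unfolding QH_ideal_def using PI SR_ideal by (rule ring.add_ideals[OF ring_from_type_algebra])
  have Q_eq: "?Q = {p + q | p q. p \<in> P_ideal v \<and> q \<in> SR_ideal \<Sigma> v lam}"
    by (auto simp: QH_ideal_def set_add_def' ring_of_type_algebra_simps)
  have g_Q: "?g j \<in> ?Q" for j
  proof -
    have "?g j \<in> P_ideal v" unfolding P_ideal_def by (intro subsetD[OF genideal_of_type_self]) blast
    then show ?thesis unfolding Q_eq using SR_0 by force
  qed
  show ?thesis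
  proof
    assume p: "p \<in> ?Q"
    \<comment> \<open>The preimage of an ideal is an ideal, so the linear forms suffice for this
      half; the Stanley-Reisner part maps to 0.\<close>
    have "ideal {p. zbar_hom p \<in> ?J} zpoly_ring"
      using J by (simp add: ideal_of_type_iff zbar_hom_0 zbar_hom_add zbar_hom_mult)
    moreover have "zbar_hom (?g j) \<in> ?J" for j
    proof -
      have "ypartial j (PO0 v lam u) \<in> ?J"
        unfolding Jac_ideal_def by (intro subsetD[OF genideal_of_type_self]) blast
      \<comment> \<open>Multiplying by the unit \<open>y_j\<close> turns the derivative back into
        the image of the linear form.\<close>
      then have "ymonom (axis j 1) * ypartial j (PO0 v lam u) \<in> ?J"
        using J by (simp add: ideal_of_type_iff)
      then show ?thesis by (simp add: ypartial_PO0 ymonom_mult_inverse flip: mult.assoc)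
    qed
    ultimately have "P_ideal v \<subseteq> {p. zbar_hom p \<in> ?J}"
      unfolding P_ideal_def by (intro ring.genideal_minimal[OF ring_from_type_algebra]) auto
    then show "zbar_hom p \<in> ?J" using p by (auto simp: Q_eq zbar_hom_add zbar_hom_SR)
  next
    assume p: "zbar_hom p \<in> ?J"
    have Q_closed: "0 \<in> ?Q" "\<And>x y. x \<in> ?Q \<Longrightarrow> y \<in> ?Q \<Longrightarrow> x + y \<in> ?Q" "\<And>x r. x \<in> ?Q \<Longrightarrow> r * x \<in> ?Q"
      using Q by (simp_all add: ideal_of_type_iff)
    \<comment> \<open>Surjectivity makes the image of an ideal an ideal:
      \<open>lift_monomials\<close> lifts the multipliers. The image contains the derivatives, hence
      all of \<open>?J\<close>.\<close>
    have "ideal (zbar_hom ` ?Q) ylaurent_ring" unfolding ideal_of_type_iff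
    proof (intro conjI ballI allI)
      show "0 \<in> zbar_hom ` ?Q" using Q_closed(1) zbar_hom_0 by (metis imageI)
      fix x assume "x \<in> zbar_hom ` ?Q"
      then obtain p where p: "p \<in> ?Q" "x = zbar_hom p" by blast
      show "x + y \<in> zbar_hom ` ?Q" if y: "y \<in> zbar_hom ` ?Q" for y
      proof -
        obtain q where q: "q \<in> ?Q" "y = zbar_hom q" using y by blast
        show ?thesis
          by (rule image_eqI[of _ _ "p + q"]) (simp_all add: p(2) q(2) zbar_hom_add Q_closed(2)[OF p(1) q(1)])
      qed
      show "r * x \<in> zbar_hom ` ?Q" for r
        by (rule image_eqI[of _ _ "lift_monomials r * p"])
          (simp_all add: p(2) zbar_hom_mult zbar_hom_lift Q_closed(3)[OF p(1)])
    qed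
    moreover have "ypartial j (PO0 v lam u) \<in> zbar_hom ` ?Q" for j
      by (rule image_eqI[of _ _ "lift_monomials (ymonom (- axis j 1)) * ?g j"])
        (simp_all add: ypartial_PO0 zbar_hom_mult zbar_hom_lift Q_closed(3)[OF g_Q])
    ultimately have "?J \<subseteq> zbar_hom ` ?Q"
      unfolding Jac_ideal_def by (intro ring.genideal_minimal[OF ring_from_type_algebra]) auto
    then obtain q where q: "q \<in> ?Q" "zbar_hom p = zbar_hom q" using p by blast
    \<comment> \<open>\<open>p\<close> and \<open>q\<close> have the same image, so they differ by
      an element of the kernel, which is the Stanley-Reisner ideal.\<close>
    then have "p - q \<in> SR_ideal \<Sigma> v lam"
      using zbar_hom_eq_0_iff[OF P, of "p - q"] by (simp add: zbar_hom_diff)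
    moreover have "0 \<in> P_ideal v" using PI by (simp add: ideal_of_type_iff)
    ultimately have "p - q \<in> ?Q"
      unfolding Q_eq by (intro CollectI exI[of _ 0] exI[of _ "p - q"]) simp
    then show "p \<in> ?Q" using Q_closed(2)[OF _ q(1), of "p - q"] by simp
  qed
qed

end

theorem proposition6p8:
  fixes \<Sigma> :: "(real ^ 'n::finite) set set"
    and v :: "'m::finite \<Rightarrow> int ^ 'n"
    and lam :: "'m \<Rightarrow> real"
    and u :: "real ^ 'n"
  assumes "compact_toric_manifold \<Sigma> v lam"
  shows "\<exists>\<psi>.
    algebra_iso
      (\<lambda>c. QH_class \<Sigma> v lam (zconst c)) (QH \<Sigma> v lam)
      (\<lambda>c. Jac_class (PO0 v lam u) (yconst c)) (Jac (PO0 v lam u)) \<psi> \<and>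
    (\<forall>i. \<psi> (QH_class \<Sigma> v lam (zvar i)) = Jac_class (PO0 v lam u) (zbar v lam u i))"
proof -
  interpret toric_potential \<Sigma> v lam u
    by unfold_locales (use assms in \<open>simp_all add: compact_toric_manifold_def\<close>)
  have P: "normal_fan (moment_polytope v lam) = \<Sigma>"
    using assms by (simp add: compact_toric_manifold_def)
  have J: "ideal (Jac_ideal (PO0 v lam u)) ylaurent_ring"
    unfolding Jac_ideal_def by (rule ideal_genideal_of_type)
  obtain \<psi> where "\<psi> \<in> ring_iso (QH \<Sigma> v lam) (Jac (PO0 v lam u))"
    "\<And>p. \<psi> (QH_class \<Sigma> v lam p) = Jac_class (PO0 v lam u) (zbar_hom p)"
    unfolding QH_def Jac_def QH_class_def Jac_class_def
    using quotient_ring_iso[OF zbar_hom_add zbar_hom_mult zbar_hom_1 surj_zbar_hom J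
        zbar_hom_ideal_iff[OF P]] by blast
  \<comment> \<open>Both the algebra structure and the values on the variables are instances of the
    coset formula, at \<open>zconst c\<close> and at \<open>zvar i\<close>.\<close>
  then show ?thesis
    by (intro exI[of _ \<psi>]) (simp add: algebra_iso_def zbar_hom_zconst zbar_hom_zvar)
qed

end
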